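(* Let $p$ be a prime and suppose that $A$ and $B$ are $p$-conjugacy separable groups. Then the restricted wreath product $A \wr B$ is $p$-conjugacy separable if and only if at least one of the following is true: (i) $B$ is a finite $p$-group; (ii) $A$ is abelian and $B$ is a $p$-group.
   Context: A group $G$ is $p$-conjugacy separable if for every pair of non-conjugate elements $g,h \in G$ there is a surjective homomorphism $\pi \colon G \to Q$ onto a finite $p$-group $Q$ such that $\pi(g)$ and $\pi(h)$ are not conjugate in $Q$. A (possibly infinite) $p$-group is a group in which every element has order a power of $p$. The restricted wreath product is $A \wr B = \left(\bigoplus_{b \in B} A\right) \rtimes B$, where elements of $\bigoplus_{b\in B} A$ are finitely supported functions $f\colon B \to A$ and $B$ acts by $(b\cdot f)(x) = f(b^{-1}x)$.
   Formalization: The "only if" direction assumes that A is nontrivial: for A trivial and B = Z all hypotheses hold and the wreath product, isomorphic to Z, is p-conjugacy separable, but neither (i) nor (ii) holds; the "if" direction is stated for all A. *)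

theory Defs
  imports "HOL-Algebra.Algebra" "HOL-Computational_Algebra.Primes"
begin

hide_const (open) Divisibility.prime

definition conj_in :: "('a, 'm) monoid_scheme \<Rightarrow> 'a \<Rightarrow> 'a \<Rightarrow> bool" where
  "conj_in G g h \<longleftrightarrow> (\<exists>x \<in> carrier G. h = x \<otimes>\<^bsub>G\<^esub> g \<otimes>\<^bsub>G\<^esub> inv\<^bsub>G\<^esub> x)"

text \<open>
  Possibly infinite \<open>p\<close>-groups. Elements of infinite order have \<open>group.ord G x = 0\<close>,
  which is not a power of a prime.
\<close>

definition p_group :: "nat \<Rightarrow> ('a, 'm) monoid_scheme \<Rightarrow> bool" where
  "p_group p G \<longleftrightarrow> group G \<and> (\<forall>x \<in> carrier G. \<exists>k. group.ord G x = p ^ k)"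

definition finite_p_group :: "nat \<Rightarrow> ('a, 'm) monoid_scheme \<Rightarrow> bool" where
  "finite_p_group p G \<longleftrightarrow> p_group p G \<and> finite (carrier G)"

text \<open>
  The quotient \<open>Q\<close> is quantified over groups whose elements are natural numbers, since
  HOL has no quantification over types. This is no restriction, every finite group being
  isomorphic to such a group; see \<open>p_conj_separable_iff_quotients\<close> below.
\<close>

definition p_conj_separable :: "nat \<Rightarrow> ('a, 'm) monoid_scheme \<Rightarrow> bool" where
  "p_conj_separable p G \<longleftrightarrow> group G \<and>
     (\<forall>g \<in> carrier G. \<forall>h \<in> carrier G. \<not> conj_in G g h \<longrightarrow>
        (\<exists>(Q :: nat monoid) \<pi>. finite_p_group p Q \<and> \<pi> \<in> epi G Q \<and> \<not> conj_in Q (\<pi> g) (\<pi> h)))"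

definition semidirect_product ::
    "('n, 'k) monoid_scheme \<Rightarrow> ('h, 'm) monoid_scheme \<Rightarrow> ('h \<Rightarrow> 'n \<Rightarrow> 'n) \<Rightarrow> ('n \<times> 'h) monoid" where
  "semidirect_product N H \<phi> =
     \<lparr>carrier = carrier N \<times> carrier H,
      monoid.mult = (\<lambda>(n, h) (n', h'). (n \<otimes>\<^bsub>N\<^esub> \<phi> h n', h \<otimes>\<^bsub>H\<^esub> h')),
      one = (\<one>\<^bsub>N\<^esub>, \<one>\<^bsub>H\<^esub>)\<rparr>"

definition shift_action :: "('b, 'm) monoid_scheme \<Rightarrow> 'b \<Rightarrow> ('b \<Rightarrow> 'a) \<Rightarrow> 'b \<Rightarrow> 'a" where
  "shift_action B b f = (\<lambda>x \<in> carrier B. f (inv\<^bsub>B\<^esub> b \<otimes>\<^bsub>B\<^esub> x))"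

text \<open>
  The base group \<open>sum_group\<close> consists of the finitely supported functions on \<open>carrier B\<close>
  (with the value \<open>undefined\<close> outside \<open>carrier B\<close>).
\<close>

definition wreath_product ::
    "('a, 'k) monoid_scheme \<Rightarrow> ('b, 'm) monoid_scheme \<Rightarrow> (('b \<Rightarrow> 'a) \<times> 'b) monoid"
    (infixr "\<wreath>" 70) where
  "A \<wreath> B = semidirect_product (sum_group (carrier B) (\<lambda>_. A)) B (shift_action B)"

lemma conj_in_hom:
  assumes "group G" "group H" "\<phi> \<in> hom G H" "g \<in> carrier G" "h \<in> carrier G" "conj_in G g h"
  shows "conj_in H (\<phi> g) (\<phi> h)"
proof -
  interpret group_hom G H \<phi>
    using assms by (simp add: group_hom_def group_hom_axioms_def)
  show ?thesis
    using assms(4-6) unfolding conj_in_def by (force simp: intro: bexI[of _ "\<phi> _"])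
qed

lemma finite_p_group_epi_image:
  assumes "finite_p_group p G" "prime p" "group H" "\<phi> \<in> epi G H"
  shows "finite_p_group p H"
proof -
  interpret group_hom G H \<phi>
    using assms by (auto simp: group_hom_def group_hom_axioms_def epi_def finite_p_group_def p_group_def)
  have im: "carrier H = \<phi> ` carrier G"
    using assms(4) by (auto simp: epi_def)
  have "\<exists>k. group.ord H y = p ^ k" if y: "y \<in> carrier H" for y
  proof -
    obtain x where x: "x \<in> carrier G" "y = \<phi> x"
      using im y by blast
    obtain k where k: "group.ord G x = p ^ k"
      using assms(1) x by (auto simp: finite_p_group_def p_group_def)
    have "x [^]\<^bsub>G\<^esub> (p ^ k) = \<one>\<^bsub>G\<^esub>"
      using G.pow_ord_eq_1[OF x(1)] unfolding k .
    then have "y [^]\<^bsub>H\<^esub> (p ^ k) = \<one>\<^bsub>H\<^esub>"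
      using hom_nat_pow[OF x(1), of "p ^ k"] x(2) by simp
    then have "group.ord H y dvd p ^ k"
      using y by (simp add: H.pow_eq_id)
    then show ?thesis
      using assms(2) by (auto simp: divides_primepow_nat)
  qed
  then show ?thesis
    using assms(1) im by (simp add: finite_p_group_def p_group_def)
qed

lemma finite_group_nat_copy:
  assumes "group Q" "finite (carrier Q)"
  obtains R :: "nat monoid" and \<phi> where "group R" "\<phi> \<in> iso Q R"
proof -
  interpret group Q by fact
  obtain f :: "_ \<Rightarrow> nat" where f: "inj_on f (carrier Q)"
    using assms(2) finite_imp_inj_to_nat_seg by blast
  define g where "g = inv_into (carrier Q) f"
  define R :: "nat monoid" where
    "R = \<lparr>carrier = f ` carrier Q, monoid.mult = (\<lambda>a b. f (g a \<otimes>\<^bsub>Q\<^esub> g b)), one = f \<one>\<^bsub>Q\<^esub>\<rparr>"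
  have gf: "g (f x) = x" if "x \<in> carrier Q" for x
    using f that by (simp add: g_def)
  have iso: "f \<in> iso Q R"
    by (auto simp: iso_def hom_def R_def gf bij_betw_def f)
  have "group (R\<lparr>one := f \<one>\<^bsub>Q\<^esub>\<rparr>)"
    by (rule iso_imp_img_group[OF iso])
  then have "group R" by (simp add: R_def)
  with iso show ?thesis by (rule that[rotated])
qed

text \<open>Finite \<open>p\<close>-quotients over any type may be used to separate conjugacy classes.\<close>

lemma p_conj_separable_quotient:
  fixes Q :: "('q, 'l) monoid_scheme"
  assumes "prime p" "group G" "g \<in> carrier G" "h \<in> carrier G"
    and "finite_p_group p Q" "\<pi> \<in> epi G Q" "\<not> conj_in Q (\<pi> g) (\<pi> h)"
  shows "\<exists>(R :: nat monoid) \<rho>. finite_p_group p R \<and> \<rho> \<in> epi G R \<and> \<not> conj_in R (\<rho> g) (\<rho> h)"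
proof -
  have Q: "group Q" "finite (carrier Q)"
    using assms by (auto simp: finite_p_group_def p_group_def)
  obtain R :: "nat monoid" and \<phi> where R: "group R" "\<phi> \<in> iso Q R"
    using finite_group_nat_copy[OF Q] by blast
  let ?\<psi> = "inv_into (carrier Q) \<phi>"
  have \<phi>: "\<phi> \<in> epi Q R"
    using R by (auto simp: epi_def iso_def bij_betw_def)
  have \<psi>: "?\<psi> \<in> hom R Q"
    using group.iso_set_sym[OF Q(1) R(2)] by (simp add: iso_def)
  have \<pi>: "\<pi> \<in> hom G Q" "\<pi> ` carrier G = carrier Q" "\<pi> g \<in> carrier Q" "\<pi> h \<in> carrier Q"
    using assms by (auto simp: epi_def)
  have "(\<phi> \<circ> \<pi>) ` carrier G = carrier R"
    unfolding image_comp [symmetric] \<pi>(2) using \<phi> by (simp add: epi_def)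
  then have "\<phi> \<circ> \<pi> \<in> epi G R"
    using \<phi> \<pi> Group.hom_compose[of \<pi> G Q \<phi> R] by (simp add: epi_def)
  moreover have "\<not> conj_in R ((\<phi> \<circ> \<pi>) g) ((\<phi> \<circ> \<pi>) h)"
  proof
    assume "conj_in R ((\<phi> \<circ> \<pi>) g) ((\<phi> \<circ> \<pi>) h)"
    moreover have "\<phi> (\<pi> g) \<in> carrier R" "\<phi> (\<pi> h) \<in> carrier R"
      using \<phi> \<pi> by (auto simp: epi_def)
    ultimately have "conj_in Q (?\<psi> (\<phi> (\<pi> g))) (?\<psi> (\<phi> (\<pi> h)))"
      using conj_in_hom[OF R(1) Q(1) \<psi>] by simp
    moreover have "inj_on \<phi> (carrier Q)"
      using R(2) by (simp add: iso_def bij_betw_def)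
    ultimately show False
      using assms(7) \<pi> by simp
  qed
  moreover have "finite_p_group p R"
    using finite_p_group_epi_image[OF assms(5,1) R(1) \<phi>] .
  ultimately show ?thesis by blast
qed

text \<open>Equivalently, \<open>Q\<close> may be taken to range over the quotients of \<open>G\<close> itself.\<close>

lemma p_conj_separable_iff_quotients:
  assumes "prime p" "group G"
  shows "p_conj_separable p G \<longleftrightarrow>
     (\<forall>g \<in> carrier G. \<forall>h \<in> carrier G. \<not> conj_in G g h \<longrightarrow>
        (\<exists>N. N \<lhd> G \<and> finite_p_group p (G Mod N) \<and> \<not> conj_in (G Mod N) (N #>\<^bsub>G\<^esub> g) (N #>\<^bsub>G\<^esub> h)))"
    (is "_ \<longleftrightarrow> ?rhs")
proof
  assume L: "p_conj_separable p G"
  show ?rhs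
  proof (intro ballI impI)
    fix g h assume gh: "g \<in> carrier G" "h \<in> carrier G" "\<not> conj_in G g h"
    then obtain Q :: "nat monoid" and \<pi>
      where Q: "finite_p_group p Q" "\<pi> \<in> epi G Q" "\<not> conj_in Q (\<pi> g) (\<pi> h)"
      using L unfolding p_conj_separable_def by blast
    then have gQ: "group Q" by (simp add: finite_p_group_def p_group_def)
    interpret group_hom G Q \<pi>
      using assms Q gQ by (simp add: group_hom_def group_hom_axioms_def epi_def)
    let ?N = "kernel G Q \<pi>"
    have surj: "\<pi> ` carrier G = carrier Q"
      using Q by (simp add: epi_def)
    have N: "?N \<lhd> G" by (rule normal_kernel)
    have gN: "group (G Mod ?N)"
      using N by (rule normal.factorgroup_is_group)
    have iso: "(\<lambda>C. the_elem (\<pi> ` C)) \<in> iso (G Mod ?N) Q"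
      by (rule FactGroup_iso_set[OF surj])
    have "inv_into (carrier (G Mod ?N)) (\<lambda>C. the_elem (\<pi> ` C)) \<in> epi Q (G Mod ?N)"
      using group.iso_set_sym[OF gN iso] by (simp add: epi_def iso_def bij_betw_def)
    then have "finite_p_group p (G Mod ?N)"
      by (rule finite_p_group_epi_image[OF Q(1) assms(1) gN])
    moreover have te: "the_elem (\<pi> ` (?N #>\<^bsub>G\<^esub> x)) = \<pi> x" if "x \<in> carrier G" for x
    proof -
      have "\<pi> y = \<pi> x" if "y \<in> ?N #>\<^bsub>G\<^esub> x" for y
        using that \<open>x \<in> carrier G\<close> by (auto simp: kernel_def r_coset_def)
      moreover have "x \<in> ?N #>\<^bsub>G\<^esub> x"
        using that N by (simp add: G.rcos_self normal_def)
      ultimately have "\<pi> ` (?N #>\<^bsub>G\<^esub> x) = {\<pi> x}"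
        by blast
      then show ?thesis by simp
    qed
    moreover have "\<not> conj_in (G Mod ?N) (?N #>\<^bsub>G\<^esub> g) (?N #>\<^bsub>G\<^esub> h)"
    proof
      assume "conj_in (G Mod ?N) (?N #>\<^bsub>G\<^esub> g) (?N #>\<^bsub>G\<^esub> h)"
      moreover have "?N #>\<^bsub>G\<^esub> x \<in> carrier (G Mod ?N)" if "x \<in> carrier G" for x
        using that by (auto simp: FactGroup_def RCOSETS_def)
      moreover have "(\<lambda>C. the_elem (\<pi> ` C)) \<in> hom (G Mod ?N) Q"
        using iso by (simp add: iso_def)
      ultimately have "conj_in Q (the_elem (\<pi> ` (?N #>\<^bsub>G\<^esub> g))) (the_elem (\<pi> ` (?N #>\<^bsub>G\<^esub> h)))"
        using conj_in_hom[OF gN gQ] gh(1,2) by blast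
      then show False
        using Q(3) gh(1,2) by (simp add: te)
    qed
    ultimately show "\<exists>N. N \<lhd> G \<and> finite_p_group p (G Mod N) \<and>
        \<not> conj_in (G Mod N) (N #>\<^bsub>G\<^esub> g) (N #>\<^bsub>G\<^esub> h)"
      using N by blast
  qed
next
  assume R: ?rhs
  show "p_conj_separable p G"
    unfolding p_conj_separable_def
  proof (intro conjI ballI impI)
    fix g h assume gh: "g \<in> carrier G" "h \<in> carrier G" "\<not> conj_in G g h"
    then obtain N where N: "N \<lhd> G" "finite_p_group p (G Mod N)"
        "\<not> conj_in (G Mod N) (N #>\<^bsub>G\<^esub> g) (N #>\<^bsub>G\<^esub> h)"
      using R by blast
    have "(\<lambda>x. N #>\<^bsub>G\<^esub> x) \<in> epi G (G Mod N)"
      using normal.r_coset_hom_Mod[OF N(1)] by (auto simp: epi_def FactGroup_def RCOSETS_def)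
    from p_conj_separable_quotient[OF assms gh(1,2) N(2) this N(3)]
    show "\<exists>(Q :: nat monoid) \<pi>. finite_p_group p Q \<and> \<pi> \<in> epi G Q \<and> \<not> conj_in Q (\<pi> g) (\<pi> h)" .
  qed (fact assms)
qed

lemma group_wreath_product:
  assumes A: "group A" and B: "group B"
  shows "group (A \<wreath> B)"
proof -
  interpret A: group A by fact
  interpret B: group B by fact
  let ?S = "sum_group (carrier B) (\<lambda>_. A)"
  interpret S: group ?S using A by simp
  have cS: "carrier ?S = {x \<in> carrier B \<rightarrow>\<^sub>E carrier A. finite {i \<in> carrier B. x i \<noteq> \<one>\<^bsub>A\<^esub>}}"
    using A by (simp add: carrier_sum_group)
  have shift_closed: "shift_action B b f \<in> carrier ?S" if b: "b \<in> carrier B" and f: "f \<in> carrier ?S" for b f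
  proof -
    have "{i \<in> carrier B. shift_action B b f i \<noteq> \<one>\<^bsub>A\<^esub>} \<subseteq> (\<lambda>x. b \<otimes>\<^bsub>B\<^esub> x) ` {i \<in> carrier B. f i \<noteq> \<one>\<^bsub>A\<^esub>}"
    proof
      fix i assume i: "i \<in> {i \<in> carrier B. shift_action B b f i \<noteq> \<one>\<^bsub>A\<^esub>}"
      then have "i = b \<otimes>\<^bsub>B\<^esub> (inv\<^bsub>B\<^esub> b \<otimes>\<^bsub>B\<^esub> i)"
        using b by (simp add: B.m_assoc [symmetric])
      then show "i \<in> (\<lambda>x. b \<otimes>\<^bsub>B\<^esub> x) ` {i \<in> carrier B. f i \<noteq> \<one>\<^bsub>A\<^esub>}"
        using i b by (auto simp: shift_action_def)
    qed
    moreover have "finite {i \<in> carrier B. f i \<noteq> \<one>\<^bsub>A\<^esub>}"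
      using f by (simp add: cS)
    ultimately have "finite {i \<in> carrier B. shift_action B b f i \<noteq> \<one>\<^bsub>A\<^esub>}"
      by (meson finite_imageI finite_subset)
    then show ?thesis
      using b f by (auto simp: cS shift_action_def PiE_iff)
  qed
  have shift_mult: "shift_action B b (f \<otimes>\<^bsub>?S\<^esub> g) = shift_action B b f \<otimes>\<^bsub>?S\<^esub> shift_action B b g"
    if "b \<in> carrier B" for b f g
    using that by (auto simp: shift_action_def fun_eq_iff)
  have shift_shift: "shift_action B (b \<otimes>\<^bsub>B\<^esub> c) f = shift_action B b (shift_action B c f)"
    if "b \<in> carrier B" "c \<in> carrier B" for b c f
    using that by (auto simp: shift_action_def fun_eq_iff B.inv_mult_group B.m_assoc)
  have shift_one: "shift_action B \<one>\<^bsub>B\<^esub> f = f" if "f \<in> carrier ?S" for f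
    using that by (auto simp: shift_action_def fun_eq_iff cS PiE_iff extensional_def)
  have shift_1: "shift_action B b \<one>\<^bsub>?S\<^esub> = \<one>\<^bsub>?S\<^esub>" if "b \<in> carrier B" for b
    using that by (auto simp: shift_action_def fun_eq_iff)
  note [simp del] = mult_sum_group one_sum_group inv_sum_group
  have carr: "carrier (A \<wreath> B) = carrier ?S \<times> carrier B"
    by (simp add: wreath_product_def semidirect_product_def)
  have mul: "(f, b) \<otimes>\<^bsub>A \<wreath> B\<^esub> (g, c) = (f \<otimes>\<^bsub>?S\<^esub> shift_action B b g, b \<otimes>\<^bsub>B\<^esub> c)" for f b g c
    by (simp add: wreath_product_def semidirect_product_def)
  have one: "\<one>\<^bsub>A \<wreath> B\<^esub> = (\<one>\<^bsub>?S\<^esub>, \<one>\<^bsub>B\<^esub>)"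
    by (simp add: wreath_product_def semidirect_product_def)
  show ?thesis
  proof (rule groupI)
    fix x assume x: "x \<in> carrier (A \<wreath> B)"
    obtain f b where fb: "x = (f, b)" "f \<in> carrier ?S" "b \<in> carrier B"
      using x by (auto simp: carr)
    let ?y = "(shift_action B (inv\<^bsub>B\<^esub> b) (inv\<^bsub>?S\<^esub> f), inv\<^bsub>B\<^esub> b)"
    have "?y \<in> carrier (A \<wreath> B)"
      using fb by (simp add: carr shift_closed)
    moreover have "?y \<otimes>\<^bsub>A \<wreath> B\<^esub> x = \<one>\<^bsub>A \<wreath> B\<^esub>"
      using fb by (simp add: mul one shift_mult [symmetric] shift_1 S.l_inv)
    ultimately show "\<exists>y\<in>carrier (A \<wreath> B). y \<otimes>\<^bsub>A \<wreath> B\<^esub> x = \<one>\<^bsub>A \<wreath> B\<^esub>"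
      by blast
  next
    fix x y z assume "x \<in> carrier (A \<wreath> B)" "y \<in> carrier (A \<wreath> B)" "z \<in> carrier (A \<wreath> B)"
    then obtain f b g c h d where "x = (f, b)" "y = (g, c)" "z = (h, d)"
        and "f \<in> carrier ?S" "g \<in> carrier ?S" "h \<in> carrier ?S"
        and "b \<in> carrier B" "c \<in> carrier B" "d \<in> carrier B"
      by (auto simp: carr)
    then show "x \<otimes>\<^bsub>A \<wreath> B\<^esub> y \<otimes>\<^bsub>A \<wreath> B\<^esub> z = x \<otimes>\<^bsub>A \<wreath> B\<^esub> (y \<otimes>\<^bsub>A \<wreath> B\<^esub> z)"
      by (simp add: mul shift_closed shift_mult shift_shift S.m_assoc B.m_assoc)
  next
    fix x y assume "x \<in> carrier (A \<wreath> B)" "y \<in> carrier (A \<wreath> B)"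
    then show "x \<otimes>\<^bsub>A \<wreath> B\<^esub> y \<in> carrier (A \<wreath> B)"
      by (auto simp add: carr mul shift_closed)
  next
    show "\<one>\<^bsub>A \<wreath> B\<^esub> \<in> carrier (A \<wreath> B)"
      by (simp add: carr one)
  next
    fix x assume "x \<in> carrier (A \<wreath> B)"
    then show "\<one>\<^bsub>A \<wreath> B\<^esub> \<otimes>\<^bsub>A \<wreath> B\<^esub> x = x"
      by (cases x) (simp add: carr one mul shift_one)
  qed
qed

end

theory Submission
  imports Defs
begin

text \<open>
  Everything is phrased through \<open>p\<close>-open normal subgroups: \<open>g\<close> and \<open>h\<close> are separated in \<open>G\<close> when
  some normal subgroup \<open>N\<close> of finite \<open>p\<close>-power index avoids all products of a conjugate of \<open>g\<close>
  with the inverse of \<open>h\<close>. Such \<open>N\<close> pull back along homomorphisms and are closed under finite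
  intersections, so finitely many separation problems can be solved one at a time.

  The basic tool in \<open>A \<wreath> B\<close> is the power trick. If \<open>c\<close> has order \<open>n > 0\<close>, then the \<open>n\<close>-th power of
  \<open>(f, c)\<close> lies in the base group; its value at \<open>x\<close>, called the orbit product, is the product of the
  values of \<open>f\<close> along the orbit of \<open>x\<close> under \<open>c\<close>. Two elements \<open>(f, c)\<close> and \<open>(g, c)\<close> are conjugate by
  a base element if and only if their orbit products are conjugate in \<open>A\<close> point by point
  (\<open>orbit_prod_conj\<close>, \<open>conj_by_base_if_orbit_prods_conj\<close>). Homomorphisms respect powers, hence orbit
  products, so this criterion can be compared between a wreath product and its quotients.

  If \<open>B\<close> is a finite \<open>p\<close>-group, every conjugator is a base element times one of finitely many elements
  of \<open>B\<close>. For each of these, a nonconjugate pair of orbit products is separated by a finite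
  \<open>p\<close>-quotient \<open>Q\<close> of \<open>A\<close>, and \<open>Q \<wreath> B\<close> is a finite \<open>p\<close>-group
  (\<open>p_conj_separable_wreath_finite\<close>). If \<open>A\<close> is abelian and \<open>B\<close> is any \<open>p\<close>-group, a quotient
  \<open>Q\<close> of \<open>B\<close> induces a homomorphism from \<open>A \<wreath> B\<close> to \<open>A \<wreath> Q\<close> by multiplying values along fibres.
  Orbit products have finite support, so a top component of a conjugator must carry one finite set to
  another; this leaves finitely many candidates, all of which are refuted in a single finite
  \<open>p\<close>-quotient \<open>Q\<close> (\<open>nonconj_in_finite_top_quotient\<close>), which reduces to the finite case.

  For the converse, let \<open>A\<close> be nontrivial and \<open>A \<wreath> B\<close> be \<open>p\<close>-conjugacy separable. If \<open>B\<close> is infinite,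
  every finite quotient kills some \<open>k \<noteq> \<one>\<close> of \<open>B\<close>, hence identifies two different coordinate copies
  of \<open>A\<close>. These commute with each other, so the image of \<open>A\<close> is abelian, and by residual finiteness
  \<open>A\<close> is abelian itself (\<open>comm_group_if_infinite_top\<close>). If some \<open>b\<close> in \<open>B\<close> had infinite order, put
  \<open>c = b\<^sup>p\<^sup>+\<^sup>1\<close>. In a finite \<open>p\<close>-group the powers of \<open>c\<close> exhaust those of \<open>b\<close>, and this makes \<open>c\<close>
  conjugate to the product \<open>[a, b] c\<close> in every finite \<open>p\<close>-quotient, for \<open>a\<close> in the coordinate at
  \<open>\<one>\<close>; the conjugation uses that \<open>A\<close> is now known to be abelian. For \<open>a \<noteq> \<one>\<close> the two
  are not conjugate in \<open>A \<wreath> B\<close>, because \<open>\<one>\<close> and \<open>b\<close> lie in different orbits of \<open>c\<close>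
  (\<open>top_torsion\<close>). Finally, a torsion group that is residually a finite \<open>p\<close>-group is a \<open>p\<close>-group.
\<close>

section \<open>Finite \<open>p\<close>-groups\<close>

lemma p_group_iff_pow:
  assumes "prime p"
  shows "p_group p G \<longleftrightarrow> group G \<and> (\<forall>x \<in> carrier G. \<exists>k::nat. x [^]\<^bsub>G\<^esub> (p ^ k) = \<one>\<^bsub>G\<^esub>)"
proof (cases "group G")
  case True
  then interpret group G .
  have "(\<exists>k. ord x = p ^ k) \<longleftrightarrow> (\<exists>k. ord x dvd p ^ k)" for x
    using divides_primepow_nat[OF assms] by blast
  then show ?thesis
    using True by (simp add: p_group_def pow_eq_id)
qed (simp add: p_group_def)

lemma finite_p_group_exponent:
  fixes G (structure)
  assumes "prime p" "finite_p_group p G"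
  obtains m :: nat where "\<And>x. x \<in> carrier G \<Longrightarrow> x [^]\<^bsub>G\<^esub> (p ^ m) = \<one>\<^bsub>G\<^esub>"
proof -
  interpret group G
    using assms by (simp add: finite_p_group_def p_group_def)
  have "\<forall>x \<in> carrier G. \<exists>k. ord x = p ^ k" and fin: "finite (carrier G)"
    using assms by (auto simp: finite_p_group_def p_group_def)
  then obtain k where k: "\<And>x. x \<in> carrier G \<Longrightarrow> ord x = p ^ k x"
    by metis
  have "x [^] (p ^ (\<Sum>y \<in> carrier G. k y)) = \<one>" if "x \<in> carrier G" for x
  proof -
    have "k x \<le> (\<Sum>y \<in> carrier G. k y)"
      using that fin by (simp add: member_le_sum)
    then show ?thesis
      using that by (simp add: pow_eq_id k le_imp_power_dvd)
  qed
  then show ?thesis by (rule that)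
qed

lemma finite_p_group_DirProd:
  assumes "prime p" "finite_p_group p G" "finite_p_group p H"
  shows "finite_p_group p (G \<times>\<times> H)"
proof -
  have G: "group G" and H: "group H"
    using assms by (simp_all add: finite_p_group_def p_group_def)
  interpret G: group G by fact
  interpret H: group H by fact
  obtain m where m: "\<And>x. x \<in> carrier G \<Longrightarrow> x [^]\<^bsub>G\<^esub> (p ^ m) = \<one>\<^bsub>G\<^esub>"
    using finite_p_group_exponent assms by blast
  obtain n where n: "\<And>x. x \<in> carrier H \<Longrightarrow> x [^]\<^bsub>H\<^esub> (p ^ n) = \<one>\<^bsub>H\<^esub>"
    using finite_p_group_exponent assms by blast
  have pow: "(x, y) [^]\<^bsub>G \<times>\<times> H\<^esub> (i::nat) = (x [^]\<^bsub>G\<^esub> i, y [^]\<^bsub>H\<^esub> i)"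
    if "x \<in> carrier G" "y \<in> carrier H" for x y i
    by (induction i) simp_all
  have "(x, y) [^]\<^bsub>G \<times>\<times> H\<^esub> (p ^ (m + n)) = \<one>\<^bsub>G \<times>\<times> H\<^esub>"
    if "x \<in> carrier G" "y \<in> carrier H" for x y
  proof -
    have "x [^]\<^bsub>G\<^esub> (p ^ (m + n)) = \<one>\<^bsub>G\<^esub>" "y [^]\<^bsub>H\<^esub> (p ^ (m + n)) = \<one>\<^bsub>H\<^esub>"
      using m n that by (metis G.nat_pow_one G.nat_pow_pow power_add)
        (metis H.nat_pow_one H.nat_pow_pow add.commute n power_add that(2))
    then show ?thesis
      using that by (simp add: pow)
  qed
  then show ?thesis
    using assms DirProd_group[OF G H]
    by (auto simp: finite_p_group_def p_group_iff_pow)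
qed

lemma finite_p_group_hom_image:
  assumes "prime p" "group G" "finite_p_group p Q" "\<pi> \<in> hom G Q"
  shows "finite_p_group p (Q\<lparr>carrier := \<pi> ` carrier G\<rparr>)"
proof -
  have Q: "group Q"
    using assms by (simp add: finite_p_group_def p_group_def)
  interpret group_hom G Q \<pi>
    using assms Q by (simp add: group_hom_def group_hom_axioms_def)
  obtain m where m: "\<And>x. x \<in> carrier Q \<Longrightarrow> x [^]\<^bsub>Q\<^esub> (p ^ m) = \<one>\<^bsub>Q\<^esub>"
    using finite_p_group_exponent assms by blast
  have sub: "subgroup (\<pi> ` carrier G) Q"
    using img_is_subgroup .
  then have grp: "group (Q\<lparr>carrier := \<pi> ` carrier G\<rparr>)"
    using H.subgroup_imp_group by blast
  show ?thesis
    unfolding finite_p_group_def p_group_iff_pow[OF assms(1)]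
  proof (intro conjI ballI exI)
    show "finite (carrier (Q\<lparr>carrier := \<pi> ` carrier G\<rparr>))"
      using assms(3) by (auto simp: finite_p_group_def intro: finite_subset[of _ "carrier Q"])
    show "x [^]\<^bsub>Q\<lparr>carrier := \<pi> ` carrier G\<rparr>\<^esub> (p ^ m) = \<one>\<^bsub>Q\<lparr>carrier := \<pi> ` carrier G\<rparr>\<^esub>"
      if "x \<in> carrier (Q\<lparr>carrier := \<pi> ` carrier G\<rparr>)" for x
      using that m by (auto simp flip: nat_pow_consistent)
  qed fact
qed

section \<open>Open normal subgroups in the pro-\<open>p\<close> topology\<close>

text \<open>
  These are the normal subgroups of \<open>p\<close>-power index, presented as kernels so that the quotient
  comes with an explicit homomorphism. Since surjectivity is not demanded, a preimage under any
  homomorphism is again of this form by composition.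
\<close>

definition p_open :: "nat \<Rightarrow> ('a, 'm) monoid_scheme \<Rightarrow> 'a set \<Rightarrow> bool" where
  "p_open p G N \<longleftrightarrow> (\<exists>(Q :: nat monoid) \<pi>. finite_p_group p Q \<and> \<pi> \<in> hom G Q \<and> N = kernel G Q \<pi>)"

lemma p_openE:
  assumes "p_open p G N" "group G"
  obtains Q :: "nat monoid" and \<pi>
  where "finite_p_group p Q" "group_hom G Q \<pi>" "N = kernel G Q \<pi>"
  using assms
  by (auto simp: p_open_def group_hom_def group_hom_axioms_def finite_p_group_def p_group_def)

text \<open>
  The target may live on any type, because a finite group has a copy on the natural numbers.
\<close>

lemma p_open_kernel:
  fixes Q :: "('q, 'l) monoid_scheme"
  assumes "prime p" "finite_p_group p Q" "\<pi> \<in> hom G Q"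
  shows "p_open p G (kernel G Q \<pi>)"
proof -
  have Q: "group Q" "finite (carrier Q)"
    using assms by (auto simp: finite_p_group_def p_group_def)
  obtain R :: "nat monoid" and \<phi> where R: "group R" "\<phi> \<in> iso Q R"
    using finite_group_nat_copy[OF Q] by blast
  then have \<phi>: "\<phi> \<in> epi Q R" and inj: "inj_on \<phi> (carrier Q)"
    by (auto simp: epi_def iso_def bij_betw_def)
  interpret \<phi>: group_hom Q R \<phi>
    using Q R \<phi> by (auto simp: epi_def group_hom_def group_hom_axioms_def)
  have "\<phi> (\<pi> x) = \<one>\<^bsub>R\<^esub> \<longleftrightarrow> \<pi> x = \<one>\<^bsub>Q\<^esub>" if "x \<in> carrier G" for x
    using inj that hom_carrier[OF assms(3)] inj_onD[OF inj, of "\<pi> x" "\<one>\<^bsub>Q\<^esub>"]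
    by (auto simp: hom_def Pi_iff)
  then have "kernel G Q \<pi> = kernel G R (\<phi> \<circ> \<pi>)"
    by (auto simp: kernel_def)
  moreover have "\<phi> \<circ> \<pi> \<in> hom G R"
    using Group.hom_compose[OF assms(3) \<phi>.homh] .
  ultimately show ?thesis
    unfolding p_open_def
    using finite_p_group_epi_image[OF assms(2,1) R(1) \<phi>] by blast
qed

lemma p_open_vimage:
  assumes "\<phi> \<in> hom G H" "p_open p H N"
  shows "p_open p G {x \<in> carrier G. \<phi> x \<in> N}"
proof -
  obtain Q :: "nat monoid" and \<pi> where Q: "finite_p_group p Q" "\<pi> \<in> hom H Q" "N = kernel H Q \<pi>"
    using assms(2) by (auto simp: p_open_def)
  have "{x \<in> carrier G. \<phi> x \<in> N} = kernel G Q (\<pi> \<circ> \<phi>)"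
    using assms(1) by (auto simp: Q(3) kernel_def hom_def Pi_iff)
  moreover have "\<pi> \<circ> \<phi> \<in> hom G Q"
    using Group.hom_compose[OF assms(1) Q(2)] .
  ultimately show ?thesis
    using Q(1) by (auto simp: p_open_def)
qed

lemma p_open_Int:
  assumes "prime p" "p_open p G M" "p_open p G N"
  shows "p_open p G (M \<inter> N)"
proof -
  obtain Q :: "nat monoid" and \<pi> where Q: "finite_p_group p Q" "\<pi> \<in> hom G Q" "M = kernel G Q \<pi>"
    using assms(2) by (auto simp: p_open_def)
  obtain R :: "nat monoid" and \<rho> where R: "finite_p_group p R" "\<rho> \<in> hom G R" "N = kernel G R \<rho>"
    using assms(3) by (auto simp: p_open_def)
  have "(\<lambda>x. (\<pi> x, \<rho> x)) \<in> hom G (Q \<times>\<times> R)"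
    using Q R by (auto simp: hom_def)
  from p_open_kernel[OF assms(1) finite_p_group_DirProd[OF assms(1) Q(1) R(1)] this]
  show ?thesis
    by (auto simp: kernel_def Q(3) R(3) elim!: back_subst[of "p_open p G"])
qed

lemma p_open_carrier:
  assumes "prime p" "group G"
  shows "p_open p G (carrier G)"
proof -
  let ?T = "singleton_group (0::nat)"
  have "finite_p_group p ?T"
    using assms(1) by (auto simp: finite_p_group_def p_group_iff_pow singleton_group_def
      intro!: groupI exI[of _ 0])
  moreover have "(\<lambda>_. 0) \<in> hom G ?T"
    by (auto simp: hom_def singleton_group_def)
  ultimately have "p_open p G (kernel G ?T (\<lambda>_. 0))"
    by (rule p_open_kernel[OF assms(1)])
  then show ?thesis by (simp add: kernel_def singleton_group_def)
qed

lemma p_open_INT: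
  assumes "prime p" "group G" "finite I" "\<And>i. i \<in> I \<Longrightarrow> p_open p G (N i)"
  shows "p_open p G {x \<in> carrier G. \<forall>i \<in> I. x \<in> N i}"
  using assms(3,4)
proof (induction I)
  case empty
  then show ?case using p_open_carrier[OF assms(1,2)] by simp
next
  case (insert i I)
  then have "p_open p G (N i \<inter> {x \<in> carrier G. \<forall>i \<in> I. x \<in> N i})"
    by (intro p_open_Int[OF assms(1)]) auto
  also have "N i \<inter> {x \<in> carrier G. \<forall>i \<in> I. x \<in> N i} = {x \<in> carrier G. \<forall>i \<in> insert i I. x \<in> N i}"
    by auto
  finally show ?case .
qed

lemma (in group_hom) conj_in_kernel_coset_iff:
  assumes "x \<in> carrier G" "g \<in> carrier G" "g' \<in> carrier G"
  shows "x \<otimes> g \<otimes> inv x \<otimes> inv g' \<in> kernel G H h \<longleftrightarrow> h x \<otimes>\<^bsub>H\<^esub> h g = h g' \<otimes>\<^bsub>H\<^esub> h x"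
proof -
  have "x \<otimes> g \<otimes> inv x \<otimes> inv g' \<in> kernel G H h \<longleftrightarrow>
      h x \<otimes>\<^bsub>H\<^esub> h g \<otimes>\<^bsub>H\<^esub> inv\<^bsub>H\<^esub> h x \<otimes>\<^bsub>H\<^esub> inv\<^bsub>H\<^esub> h g' = \<one>\<^bsub>H\<^esub>"
    using assms by (simp add: kernel_def)
  also have "\<dots> \<longleftrightarrow> h x \<otimes>\<^bsub>H\<^esub> h g \<otimes>\<^bsub>H\<^esub> inv\<^bsub>H\<^esub> h x = h g'"
    using assms by (metis H.inv_equality H.inv_inv H.r_inv H.inv_closed H.m_closed hom_closed)
  also have "\<dots> \<longleftrightarrow> h x \<otimes>\<^bsub>H\<^esub> h g = h g' \<otimes>\<^bsub>H\<^esub> h x"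
    using assms by (metis H.inv_solve_right' H.m_closed hom_closed)
  finally show ?thesis .
qed

lemma (in group) conj_in_iff_commute:
  assumes "g \<in> carrier G" "h \<in> carrier G"
  shows "conj_in G g h \<longleftrightarrow> (\<exists>x \<in> carrier G. x \<otimes> g = h \<otimes> x)"
  unfolding conj_in_def using assms by (metis inv_solve_right m_closed)

text \<open>
  Conjugacy in a quotient by \<open>N\<close>, expressed inside \<open>G\<close>: no conjugate of \<open>g\<close> lies in the coset of
  \<open>h\<close>. This form makes it possible to let \<open>N\<close> depend on the conjugator and to intersect afterwards.
\<close>

definition p_separated :: "nat \<Rightarrow> ('a, 'm) monoid_scheme \<Rightarrow> 'a \<Rightarrow> 'a \<Rightarrow> bool" where
  "p_separated p G g h \<longleftrightarrow> (\<exists>N. p_open p G N \<and>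
     (\<forall>x \<in> carrier G. x \<otimes>\<^bsub>G\<^esub> g \<otimes>\<^bsub>G\<^esub> inv\<^bsub>G\<^esub> x \<otimes>\<^bsub>G\<^esub> inv\<^bsub>G\<^esub> h \<notin> N))"

lemma p_conj_separable_iff:
  assumes "prime p" "group G"
  shows "p_conj_separable p G \<longleftrightarrow>
    (\<forall>g \<in> carrier G. \<forall>h \<in> carrier G. \<not> conj_in G g h \<longrightarrow> p_separated p G g h)"
proof
  assume L: "p_conj_separable p G"
  show "\<forall>g \<in> carrier G. \<forall>h \<in> carrier G. \<not> conj_in G g h \<longrightarrow> p_separated p G g h"
  proof (intro ballI impI)
    fix g h assume gh: "g \<in> carrier G" "h \<in> carrier G" "\<not> conj_in G g h"
    then obtain Q :: "nat monoid" and \<pi>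
      where Q: "finite_p_group p Q" "\<pi> \<in> epi G Q" "\<not> conj_in Q (\<pi> g) (\<pi> h)"
      using L unfolding p_conj_separable_def by blast
    interpret group_hom G Q \<pi>
      using Q assms by (auto simp: finite_p_group_def p_group_def epi_def group_hom_def
          group_hom_axioms_def)
    have "p_open p G (kernel G Q \<pi>)"
      using p_open_kernel[OF assms(1) Q(1) homh] .
    moreover have "x \<otimes>\<^bsub>G\<^esub> g \<otimes>\<^bsub>G\<^esub> inv\<^bsub>G\<^esub> x \<otimes>\<^bsub>G\<^esub> inv\<^bsub>G\<^esub> h \<notin> kernel G Q \<pi>" if "x \<in> carrier G" for x
      using gh Q(3) that by (auto simp: conj_in_kernel_coset_iff H.conj_in_iff_commute)
    ultimately show "p_separated p G g h"
      unfolding p_separated_def by blast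
  qed
next
  assume R: "\<forall>g \<in> carrier G. \<forall>h \<in> carrier G. \<not> conj_in G g h \<longrightarrow> p_separated p G g h"
  show "p_conj_separable p G"
    unfolding p_conj_separable_def
  proof (intro conjI ballI impI)
    fix g h assume gh: "g \<in> carrier G" "h \<in> carrier G" "\<not> conj_in G g h"
    then obtain N where N: "p_open p G N"
      "\<And>x. x \<in> carrier G \<Longrightarrow> x \<otimes>\<^bsub>G\<^esub> g \<otimes>\<^bsub>G\<^esub> inv\<^bsub>G\<^esub> x \<otimes>\<^bsub>G\<^esub> inv\<^bsub>G\<^esub> h \<notin> N"
      using R unfolding p_separated_def by blast
    obtain Q :: "nat monoid" and \<pi>
      where Q: "finite_p_group p Q" "group_hom G Q \<pi>" "N = kernel G Q \<pi>"
      using p_openE[OF N(1) assms(2)] by blast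
    interpret group_hom G Q \<pi> by fact
    let ?R = "Q\<lparr>carrier := \<pi> ` carrier G\<rparr>"
    have R: "finite_p_group p ?R"
      using finite_p_group_hom_image[OF assms Q(1) homh] .
    interpret R: group ?R
      using R by (simp add: finite_p_group_def p_group_def)
    have "\<pi> \<in> epi G ?R"
      by (auto simp: epi_def hom_def)
    moreover have "\<not> conj_in ?R (\<pi> g) (\<pi> h)"
      using gh N(2) by (auto simp: R.conj_in_iff_commute Q(3) conj_in_kernel_coset_iff)
    ultimately show "\<exists>(Q :: nat monoid) \<pi>. finite_p_group p Q \<and> \<pi> \<in> epi G Q \<and> \<not> conj_in Q (\<pi> g) (\<pi> h)"
      using R by blast
  qed fact
qed

lemma p_separated_vimage:
  assumes "group G" "group H" "\<phi> \<in> hom G H" "g \<in> carrier G" "h \<in> carrier G"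
    and "p_separated p H (\<phi> g) (\<phi> h)"
  shows "p_separated p G g h"
proof -
  interpret group_hom G H \<phi>
    using assms by (simp add: group_hom_def group_hom_axioms_def)
  obtain N where N: "p_open p H N"
    "\<And>x. x \<in> carrier H \<Longrightarrow> x \<otimes>\<^bsub>H\<^esub> \<phi> g \<otimes>\<^bsub>H\<^esub> inv\<^bsub>H\<^esub> x \<otimes>\<^bsub>H\<^esub> inv\<^bsub>H\<^esub> \<phi> h \<notin> N"
    using assms(6) unfolding p_separated_def by blast
  have "x \<otimes>\<^bsub>G\<^esub> g \<otimes>\<^bsub>G\<^esub> inv\<^bsub>G\<^esub> x \<otimes>\<^bsub>G\<^esub> inv\<^bsub>G\<^esub> h \<notin> {x \<in> carrier G. \<phi> x \<in> N}" if "x \<in> carrier G" for x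
    using that assms(4,5) N(2)[of "\<phi> x"] by simp
  then show ?thesis
    unfolding p_separated_def using p_open_vimage[OF assms(3) N(1)] by blast
qed

text \<open>
  Only the identity is conjugate to the identity, so conjugacy separability applied to \<open>x y\<^sup>-\<^sup>1\<close> and
  \<open>\<one>\<close> gives residual finiteness.
\<close>

lemma p_conj_separable_residually_p:
  fixes G (structure)
  assumes "prime p" "p_conj_separable p G" "x \<in> carrier G" "y \<in> carrier G" "x \<noteq> y"
  obtains N where "p_open p G N" "x \<otimes>\<^bsub>G\<^esub> inv\<^bsub>G\<^esub> y \<notin> N"
proof -
  interpret group G
    using assms(2) by (simp add: p_conj_separable_def)
  let ?z = "x \<otimes> inv y"
  have "?z \<noteq> \<one>"
    using assms(3-5) by (metis inv_closed inv_equality inv_inv)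
  then have "\<not> conj_in G ?z \<one>"
    using assms(3,4) by (auto simp: conj_in_iff_commute) 
  then obtain N where N: "p_open p G N" "\<And>x. x \<in> carrier G \<Longrightarrow> x \<otimes> ?z \<otimes> inv x \<otimes> inv \<one> \<notin> N"
    using assms p_conj_separable_iff[OF assms(1) is_group] unfolding p_separated_def
    by (meson inv_closed m_closed one_closed)
  from N(2)[of \<one>] have "?z \<notin> N"
    using assms(3,4) by simp
  then show ?thesis using that N(1) by blast
qed

lemma p_conj_separable_inj_on:
  fixes G (structure)
  assumes "prime p" "p_conj_separable p G" "finite Z" "Z \<subseteq> carrier G"
  obtains Q :: "nat monoid" and \<pi>
  where "finite_p_group p Q" "group_hom G Q \<pi>" "inj_on \<pi> Z"
proof -
  interpret group G
    using assms(2) by (simp add: p_conj_separable_def)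
  define I where "I = {(x, y). x \<in> Z \<and> y \<in> Z \<and> x \<noteq> y}"
  have "I \<subseteq> Z \<times> Z" by (auto simp: I_def)
  then have "finite I"
    using assms(3) finite_subset by fastforce
  have "\<forall>i \<in> I. \<exists>N. p_open p G N \<and> fst i \<otimes> inv snd i \<notin> N"
  proof
    fix i assume i: "i \<in> I"
    show "\<exists>N. p_open p G N \<and> fst i \<otimes> inv snd i \<notin> N"
      by (rule p_conj_separable_residually_p[OF assms(1,2), of "fst i" "snd i"])
        (use i assms(4) in \<open>auto simp: I_def\<close>)
  qed
  then obtain N where N: "\<And>i. i \<in> I \<Longrightarrow> p_open p G (N i)" "\<And>i. i \<in> I \<Longrightarrow> fst i \<otimes> inv snd i \<notin> N i"
    by metis
  let ?M = "{x \<in> carrier G. \<forall>i \<in> I. x \<in> N i}"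
  have "p_open p G ?M"
    using p_open_INT[OF assms(1) is_group \<open>finite I\<close> N(1)] .
  then obtain Q :: "nat monoid" and \<pi>
    where Q: "finite_p_group p Q" "group_hom G Q \<pi>" "?M = kernel G Q \<pi>"
    using p_openE is_group by blast
  interpret \<pi>: group_hom G Q \<pi> by fact
  have "inj_on \<pi> Z"
  proof (rule inj_onI, rule ccontr)
    fix x y assume xy: "x \<in> Z" "y \<in> Z" "\<pi> x = \<pi> y" "x \<noteq> y"
    then have "x \<in> carrier G" "y \<in> carrier G"
      using assms(4) by auto
    with xy have "x \<otimes> inv y \<in> kernel G Q \<pi>"
      by (simp add: kernel_def)
    then have "x \<otimes> inv y \<in> N (x, y)"
      using xy unfolding Q(3)[symmetric] by (auto simp: I_def)
    then show False
      using N(2)[of "(x, y)"] xy by (auto simp: I_def)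
  qed
  with Q(1,2) show ?thesis by (rule that)
qed

section \<open>Computing in wreath products\<close>

lemma (in monoid) commute_pow_shift:
  assumes "x \<in> carrier G" "y \<in> carrier G" "z \<in> carrier G" "x \<otimes> y = z \<otimes> x"
  shows "x \<otimes> y [^] (n::nat) = z [^] n \<otimes> x"
proof (induction n)
  case (Suc n)
  have "x \<otimes> y [^] Suc n = (x \<otimes> y [^] n) \<otimes> y"
    using assms by (simp add: m_assoc)
  also have "\<dots> = z [^] n \<otimes> (x \<otimes> y)"
    using assms by (simp only: Suc) (simp add: m_assoc)
  also have "\<dots> = z [^] Suc n \<otimes> x"
    using assms by (simp add: m_assoc)
  finally show ?case .
qed (use assms in simp)

lemma mult_wreath:
  "(f, b) \<otimes>\<^bsub>A \<wreath> B\<^esub> (g, c) = (\<lambda>x \<in> carrier B. f x \<otimes>\<^bsub>A\<^esub> g (inv\<^bsub>B\<^esub> b \<otimes>\<^bsub>B\<^esub> x), b \<otimes>\<^bsub>B\<^esub> c)"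
  by (auto simp: wreath_product_def semidirect_product_def shift_action_def)

lemma one_wreath: "\<one>\<^bsub>A \<wreath> B\<^esub> = (\<lambda>x \<in> carrier B. \<one>\<^bsub>A\<^esub>, \<one>\<^bsub>B\<^esub>)"
  by (simp add: wreath_product_def semidirect_product_def)

locale wreath_groups = A: group A + B: group B
  for A :: "('a, 'k) monoid_scheme" and B :: "('b, 'm) monoid_scheme"
begin

sublocale W: group "A \<wreath> B"
  by (rule group_wreath_product) unfold_locales

lemma carrier_wreath:
  "(f, b) \<in> carrier (A \<wreath> B) \<longleftrightarrow>
    f \<in> carrier B \<rightarrow>\<^sub>E carrier A \<and> finite {x \<in> carrier B. f x \<noteq> \<one>\<^bsub>A\<^esub>} \<and> b \<in> carrier B"
  using A.is_group by (simp add: wreath_product_def semidirect_product_def carrier_sum_group)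

lemma wreath_closed:
  assumes "(f, b) \<in> carrier (A \<wreath> B)"
  shows "b \<in> carrier B" "x \<in> carrier B \<Longrightarrow> f x \<in> carrier A"
    "finite {x \<in> carrier B. f x \<noteq> \<one>\<^bsub>A\<^esub>}" "f \<in> extensional (carrier B)"
  using assms by (auto simp: carrier_wreath PiE_iff)

lemma snd_hom: "snd \<in> hom (A \<wreath> B) B"
  by (auto simp: hom_def carrier_wreath mult_wreath)

lemma snd_pow:
  assumes "(f, b) \<in> carrier (A \<wreath> B)"
  shows "snd ((f, b) [^]\<^bsub>A \<wreath> B\<^esub> (n::nat)) = b [^]\<^bsub>B\<^esub> n"
proof -
  interpret group_hom "A \<wreath> B" B snd
    using snd_hom by unfold_locales
  show ?thesis
    using hom_nat_pow[OF assms] by simp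
qed

lemma top_closed: "b \<in> carrier B \<Longrightarrow> (\<lambda>x \<in> carrier B. \<one>\<^bsub>A\<^esub>, b) \<in> carrier (A \<wreath> B)"
  by (auto simp: carrier_wreath)

lemma base_eq_top_mult:
  assumes "(f, b) \<in> carrier (A \<wreath> B)"
  shows "(f, \<one>\<^bsub>B\<^esub>) \<in> carrier (A \<wreath> B)"
    "(f, b) = (f, \<one>\<^bsub>B\<^esub>) \<otimes>\<^bsub>A \<wreath> B\<^esub> (\<lambda>x \<in> carrier B. \<one>\<^bsub>A\<^esub>, b)"
proof -
  show "(f, \<one>\<^bsub>B\<^esub>) \<in> carrier (A \<wreath> B)"
    using assms by (auto simp: carrier_wreath)
  show "(f, b) = (f, \<one>\<^bsub>B\<^esub>) \<otimes>\<^bsub>A \<wreath> B\<^esub> (\<lambda>x \<in> carrier B. \<one>\<^bsub>A\<^esub>, b)"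
    using wreath_closed[OF assms]
    by (auto simp: mult_wreath fun_eq_iff extensional_def)
qed

text \<open>
  At \<open>x\<close> this is \<open>f x \<otimes> f (c\<^sup>-\<^sup>1 x) \<otimes> \<dots> \<otimes> f (c\<^sup>1\<^sup>-\<^sup>n x)\<close>, the product of \<open>f\<close> along the first \<open>n\<close> points of the
  backward orbit of \<open>x\<close> under \<open>c\<close>. Reading it off from the power \<open>(f, c)\<^sup>n\<close> makes it
  automatic that homomorphisms and conjugations preserve it.
\<close>

definition orbit_prod :: "('b \<Rightarrow> 'a) \<Rightarrow> 'b \<Rightarrow> nat \<Rightarrow> 'b \<Rightarrow> 'a" where
  "orbit_prod f c n = fst ((f, c) [^]\<^bsub>A \<wreath> B\<^esub> n)"

lemma pow_eq_orbit_prod: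
  assumes "(f, c) \<in> carrier (A \<wreath> B)"
  shows "(f, c) [^]\<^bsub>A \<wreath> B\<^esub> n = (orbit_prod f c n, c [^]\<^bsub>B\<^esub> n)"
  using snd_pow[OF assms] by (simp add: orbit_prod_def prod_eq_iff)

lemma orbit_prod_closed:
  assumes "(f, c) \<in> carrier (A \<wreath> B)"
  shows "(orbit_prod f c n, c [^]\<^bsub>B\<^esub> n) \<in> carrier (A \<wreath> B)"
    "x \<in> carrier B \<Longrightarrow> orbit_prod f c n x \<in> carrier A"
proof -
  show "(orbit_prod f c n, c [^]\<^bsub>B\<^esub> n) \<in> carrier (A \<wreath> B)"
    using W.nat_pow_closed[OF assms] by (simp add: pow_eq_orbit_prod[OF assms])
  then show "x \<in> carrier B \<Longrightarrow> orbit_prod f c n x \<in> carrier A"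
    by (rule wreath_closed)
qed

lemma orbit_prod_0: "x \<in> carrier B \<Longrightarrow> orbit_prod f c 0 x = \<one>\<^bsub>A\<^esub>"
  by (simp add: orbit_prod_def one_wreath)

lemma orbit_prod_Suc:
  assumes "(f, c) \<in> carrier (A \<wreath> B)" "x \<in> carrier B"
  shows "orbit_prod f c (Suc n) x = orbit_prod f c n x \<otimes>\<^bsub>A\<^esub> f (inv\<^bsub>B\<^esub> (c [^]\<^bsub>B\<^esub> n) \<otimes>\<^bsub>B\<^esub> x)"
proof -
  have "orbit_prod f c (Suc n) = fst ((orbit_prod f c n, c [^]\<^bsub>B\<^esub> n) \<otimes>\<^bsub>A \<wreath> B\<^esub> (f, c))"
    unfolding orbit_prod_def[of f c "Suc n"] W.nat_pow_Suc
    by (subst pow_eq_orbit_prod[OF assms(1)]) (rule refl)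
  then show ?thesis
    using assms(2) by (simp add: mult_wreath)
qed

text \<open>
  A conjugator of two elements also conjugates their \<open>n\<close>-th powers, which here lie in the base group.
\<close>

lemma orbit_prod_conj:
  assumes "(f, c) \<in> carrier (A \<wreath> B)" "(g, c) \<in> carrier (A \<wreath> B)" "(h, d) \<in> carrier (A \<wreath> B)"
    and "(h, d) \<otimes>\<^bsub>A \<wreath> B\<^esub> (f, c) = (g, c) \<otimes>\<^bsub>A \<wreath> B\<^esub> (h, d)"
    and "c [^]\<^bsub>B\<^esub> n = \<one>\<^bsub>B\<^esub>" "x \<in> carrier B"
  shows "h x \<otimes>\<^bsub>A\<^esub> orbit_prod f c n (inv\<^bsub>B\<^esub> d \<otimes>\<^bsub>B\<^esub> x) = orbit_prod g c n x \<otimes>\<^bsub>A\<^esub> h x"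
proof -
  have "(h, d) \<otimes>\<^bsub>A \<wreath> B\<^esub> (f, c) [^]\<^bsub>A \<wreath> B\<^esub> n = (g, c) [^]\<^bsub>A \<wreath> B\<^esub> n \<otimes>\<^bsub>A \<wreath> B\<^esub> (h, d)"
    by (rule W.commute_pow_shift) (use assms in simp_all)
  then show ?thesis
    using assms by (simp add: pow_eq_orbit_prod mult_wreath fun_eq_iff split: if_splits)
qed

text \<open>
  Being a conjugator means solving \<open>h (c\<^sup>-\<^sup>1 x) = (g x)\<^sup>-\<^sup>1 \<otimes> h x \<otimes> f x\<close>, a recursion along the orbits
  of \<open>c\<close>. On each orbit its solution is determined by the value \<open>u\<close> at a representative \<open>r\<close>: after \<open>i\<close>
  steps it is \<open>G\<^sub>i\<^sup>-\<^sup>1 \<otimes> u \<otimes> F\<^sub>i\<close> with the orbit products \<open>F\<^sub>i\<close>, \<open>G\<^sub>i\<close> of \<open>f\<close>, \<open>g\<close> at \<open>r\<close>. After \<open>n\<close> steps it must return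
  to \<open>u\<close>, which says that \<open>u\<close> conjugates \<open>F\<^sub>n\<close> to \<open>G\<^sub>n\<close>.
\<close>

lemma conj_by_base_if_orbit_prods_conj:
  assumes f: "(f, c) \<in> carrier (A \<wreath> B)" and g: "(g, c) \<in> carrier (A \<wreath> B)"
    and n: "B.ord c = n" "n > 0"
    and conj: "\<And>x. x \<in> carrier B \<Longrightarrow> conj_in A (orbit_prod f c n x) (orbit_prod g c n x)"
  shows "\<exists>h. (h, \<one>\<^bsub>B\<^esub>) \<in> carrier (A \<wreath> B) \<and>
    (h, \<one>\<^bsub>B\<^esub>) \<otimes>\<^bsub>A \<wreath> B\<^esub> (f, c) = (g, c) \<otimes>\<^bsub>A \<wreath> B\<^esub> (h, \<one>\<^bsub>B\<^esub>)"
proof -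
  note [simp] = wreath_closed[OF f] wreath_closed[OF g] orbit_prod_closed(2)[OF f]
    orbit_prod_closed(2)[OF g] orbit_prod_0
  let ?F = "orbit_prod f c" and ?G = "orbit_prod g c"
  define orb where "orb x = {c [^]\<^bsub>B\<^esub> i \<otimes>\<^bsub>B\<^esub> x |i::nat. True}" for x
  define r where "r x = (SOME y. y \<in> orb x)" for x
  define idx where "idx x = (SOME i. i < n \<and> c [^]\<^bsub>B\<^esub> i \<otimes>\<^bsub>B\<^esub> x = r x)" for x
  \<comment> \<open>Choosing \<open>\<one>\<close> whenever possible keeps the support of \<open>h\<close> finite.\<close>
  define u where "u y = (if ?F n y = ?G n y then \<one>\<^bsub>A\<^esub>
    else SOME a. a \<in> carrier A \<and> a \<otimes>\<^bsub>A\<^esub> ?F n y = ?G n y \<otimes>\<^bsub>A\<^esub> a)" for y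
  define h where "h = (\<lambda>x \<in> carrier B. inv\<^bsub>A\<^esub> (?G (idx x) (r x)) \<otimes>\<^bsub>A\<^esub> u (r x) \<otimes>\<^bsub>A\<^esub> ?F (idx x) (r x))"
  have u: "u y \<in> carrier A \<and> u y \<otimes>\<^bsub>A\<^esub> ?F n y = ?G n y \<otimes>\<^bsub>A\<^esub> u y" if y: "y \<in> carrier B" for y
  proof (cases "?F n y = ?G n y")
    case True
    then show ?thesis using y by (simp add: u_def)
  next
    case False
    have "\<exists>a. a \<in> carrier A \<and> a \<otimes>\<^bsub>A\<^esub> ?F n y = ?G n y \<otimes>\<^bsub>A\<^esub> a"
      using conj[OF y] y by (auto simp: A.conj_in_iff_commute)
    from someI_ex[OF this] show ?thesis
      using False by (simp add: u_def)
  qed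
  have cn: "c [^]\<^bsub>B\<^esub> n = \<one>\<^bsub>B\<^esub>"
    using B.pow_ord_eq_1[of c] n by simp
  have pow_mod: "c [^]\<^bsub>B\<^esub> i = c [^]\<^bsub>B\<^esub> (i mod n)" for i
  proof -
    have "c [^]\<^bsub>B\<^esub> i = c [^]\<^bsub>B\<^esub> (n * (i div n) + i mod n)" by simp
    also have "\<dots> = (c [^]\<^bsub>B\<^esub> n) [^]\<^bsub>B\<^esub> (i div n) \<otimes>\<^bsub>B\<^esub> c [^]\<^bsub>B\<^esub> (i mod n)"
      by (simp only: B.nat_pow_pow B.nat_pow_mult wreath_closed(1)[OF f])
    finally show ?thesis by (simp add: cn)
  qed
  have pow_inj: "i = j" if "c [^]\<^bsub>B\<^esub> i = c [^]\<^bsub>B\<^esub> j" "i < n" "j < n" for i j :: nat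
    using B.ord_inj[of c] that n by (auto simp: inj_on_def)
  have r: "r x \<in> orb x" for x
  proof -
    have "c [^]\<^bsub>B\<^esub> (0::nat) \<otimes>\<^bsub>B\<^esub> x \<in> orb x"
      unfolding orb_def by blast
    then show ?thesis
      unfolding r_def by (rule someI)
  qed
  have idx: "idx x < n \<and> c [^]\<^bsub>B\<^esub> idx x \<otimes>\<^bsub>B\<^esub> x = r x" for x
  proof -
    obtain i :: nat where "c [^]\<^bsub>B\<^esub> i \<otimes>\<^bsub>B\<^esub> x = r x"
      using r[of x] by (auto simp: orb_def)
    then have "i mod n < n \<and> c [^]\<^bsub>B\<^esub> (i mod n) \<otimes>\<^bsub>B\<^esub> x = r x"
      using n pow_mod[of i] by simp
    then show ?thesis
      unfolding idx_def by (rule someI)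
  qed
  have idxI: "idx x = i" if "i < n" "c [^]\<^bsub>B\<^esub> i \<otimes>\<^bsub>B\<^esub> x = r x" "x \<in> carrier B" for i x
    using that idx[of x] pow_inj[of "idx x" i] by (metis B.nat_pow_closed B.right_cancel wreath_closed(1)[OF f])
  have rc: "r x \<in> carrier B" if "x \<in> carrier B" for x
    using r[of x] that by (auto simp: orb_def)
  have xr: "x = inv\<^bsub>B\<^esub> (c [^]\<^bsub>B\<^esub> idx x) \<otimes>\<^bsub>B\<^esub> r x" if "x \<in> carrier B" for x
    using idx[of x] that by (metis B.inv_solve_left B.nat_pow_closed rc wreath_closed(1)[OF f])
  have hA: "h x \<in> carrier A" if "x \<in> carrier B" for x
    using that rc u by (simp add: h_def)
  have rec: "h x \<otimes>\<^bsub>A\<^esub> f x = g x \<otimes>\<^bsub>A\<^esub> h (inv\<^bsub>B\<^esub> c \<otimes>\<^bsub>B\<^esub> x)" if x: "x \<in> carrier B" for x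
  proof -
    let ?x' = "inv\<^bsub>B\<^esub> c \<otimes>\<^bsub>B\<^esub> x"
    let ?i = "idx x" and ?r = "r x"
    have step: "c [^]\<^bsub>B\<^esub> Suc i \<otimes>\<^bsub>B\<^esub> ?x' = c [^]\<^bsub>B\<^esub> i \<otimes>\<^bsub>B\<^esub> x" for i
      using x by (simp add: B.m_assoc) (simp add: B.m_assoc[symmetric])
    have "orb ?x' = orb x"
    proof
      show "orb x \<subseteq> orb ?x'"
        unfolding orb_def using step[symmetric] by blast
      show "orb ?x' \<subseteq> orb x"
      proof
        fix y assume "y \<in> orb ?x'"
        then obtain i :: nat where "y = c [^]\<^bsub>B\<^esub> i \<otimes>\<^bsub>B\<^esub> ?x'"
          unfolding orb_def by blast
        moreover have "c [^]\<^bsub>B\<^esub> i = c [^]\<^bsub>B\<^esub> Suc (i + (n - 1))"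
          using pow_mod[of "i + n"] pow_mod[of i] n(2) by simp
        ultimately have "y = c [^]\<^bsub>B\<^esub> (i + (n - 1)) \<otimes>\<^bsub>B\<^esub> x"
          using step by simp
        then show "y \<in> orb x"
          unfolding orb_def by blast
      qed
    qed
    then have r': "r ?x' = ?r" by (simp add: r_def)
    have fx: "f x = f (inv\<^bsub>B\<^esub> (c [^]\<^bsub>B\<^esub> ?i) \<otimes>\<^bsub>B\<^esub> ?r)" and gx: "g x = g (inv\<^bsub>B\<^esub> (c [^]\<^bsub>B\<^esub> ?i) \<otimes>\<^bsub>B\<^esub> ?r)"
      using xr[OF x] by simp_all
    have FS: "?F (Suc ?i) ?r = ?F ?i ?r \<otimes>\<^bsub>A\<^esub> f x"
      unfolding fx by (rule orbit_prod_Suc[OF f rc[OF x]])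
    have GS: "?G (Suc ?i) ?r = ?G ?i ?r \<otimes>\<^bsub>A\<^esub> g x"
      unfolding gx by (rule orbit_prod_Suc[OF g rc[OF x]])
    have cancel: "g x \<otimes>\<^bsub>A\<^esub> inv\<^bsub>A\<^esub> (?G ?i ?r \<otimes>\<^bsub>A\<^esub> g x) = inv\<^bsub>A\<^esub> (?G ?i ?r)"
      using x rc by (simp add: A.inv_mult_group) (simp add: A.m_assoc[symmetric])
    have F: "h x \<otimes>\<^bsub>A\<^esub> f x = inv\<^bsub>A\<^esub> (?G ?i ?r) \<otimes>\<^bsub>A\<^esub> u ?r \<otimes>\<^bsub>A\<^esub> ?F (Suc ?i) ?r"
      using x rc u by (simp add: h_def FS A.m_assoc)
    \<comment> \<open>The index of \<open>c\<^sup>-\<^sup>1 x\<close> is the successor of that of \<open>x\<close>, wrapping around to \<open>0\<close> at the end of the orbit.\<close>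
    show ?thesis
    proof (cases "Suc ?i < n")
      case True
      then have "idx ?x' = Suc ?i"
        using idx[of x] x r' step[of ?i] by (intro idxI) auto
      then have "g x \<otimes>\<^bsub>A\<^esub> h ?x' = g x \<otimes>\<^bsub>A\<^esub> inv\<^bsub>A\<^esub> (?G ?i ?r \<otimes>\<^bsub>A\<^esub> g x) \<otimes>\<^bsub>A\<^esub> u ?r \<otimes>\<^bsub>A\<^esub> ?F (Suc ?i) ?r"
        using x rc u r' by (simp add: h_def GS A.m_assoc)
      then show ?thesis
        unfolding cancel F by simp
    next
      case False
      then have n': "Suc ?i = n"
        using idx[of x] by simp
      have "?x' = c [^]\<^bsub>B\<^esub> Suc ?i \<otimes>\<^bsub>B\<^esub> ?x'"
        using n' cn x by simp
      also have "\<dots> = ?r"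
        using step idx[of x] by simp
      finally have "idx ?x' = 0"
        using n x r' rc[OF x] by (intro idxI) auto
      then have "h ?x' = u ?r"
        using x rc u r' by (simp add: h_def)
      moreover have "u ?r \<otimes>\<^bsub>A\<^esub> ?F (Suc ?i) ?r = ?G ?i ?r \<otimes>\<^bsub>A\<^esub> g x \<otimes>\<^bsub>A\<^esub> u ?r"
        using u[OF rc[OF x]] GS n' by simp
      then have "h x \<otimes>\<^bsub>A\<^esub> f x = inv\<^bsub>A\<^esub> (?G ?i ?r) \<otimes>\<^bsub>A\<^esub> (?G ?i ?r \<otimes>\<^bsub>A\<^esub> g x \<otimes>\<^bsub>A\<^esub> u ?r)"
        unfolding F using u[OF rc[OF x]] rc[OF x] by (simp add: A.m_assoc)
      then have "h x \<otimes>\<^bsub>A\<^esub> f x = g x \<otimes>\<^bsub>A\<^esub> u ?r"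
        using x rc u by (simp add: A.m_assoc) (simp add: A.m_assoc[symmetric])
      ultimately show ?thesis by simp
    qed
  qed
  \<comment> \<open>The function \<open>h\<close> is trivial on every orbit that misses the supports of \<open>f\<close> and \<open>g\<close>.\<close>
  have "{x \<in> carrier B. h x \<noteq> \<one>\<^bsub>A\<^esub>} \<subseteq>
      (\<lambda>(i, j, s). inv\<^bsub>B\<^esub> (c [^]\<^bsub>B\<^esub> i) \<otimes>\<^bsub>B\<^esub> (c [^]\<^bsub>B\<^esub> j \<otimes>\<^bsub>B\<^esub> s)) `
      ({..<n} \<times> {..<n} \<times> ({x \<in> carrier B. f x \<noteq> \<one>\<^bsub>A\<^esub>} \<union> {x \<in> carrier B. g x \<noteq> \<one>\<^bsub>A\<^esub>}))"
    (is "?S \<subseteq> ?T")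
  proof
    fix x assume "x \<in> ?S"
    then have x: "x \<in> carrier B" and hx: "h x \<noteq> \<one>\<^bsub>A\<^esub>" by auto
    let ?s = "\<lambda>j. inv\<^bsub>B\<^esub> (c [^]\<^bsub>B\<^esub> j) \<otimes>\<^bsub>B\<^esub> r x"
    have "\<exists>j < n. f (?s j) \<noteq> \<one>\<^bsub>A\<^esub> \<or> g (?s j) \<noteq> \<one>\<^bsub>A\<^esub>"
    proof (rule ccontr)
      assume triv: "\<not> ?thesis"
      have "?F j (r x) = \<one>\<^bsub>A\<^esub> \<and> ?G j (r x) = \<one>\<^bsub>A\<^esub>" if "j \<le> n" for j
        using that
      proof (induction j)
        case (Suc j)
        then show ?case
          using triv rc[OF x] orbit_prod_Suc[OF f rc[OF x], of j] orbit_prod_Suc[OF g rc[OF x], of j]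
          by auto
      qed (use rc[OF x] in simp)
      then have "h x = \<one>\<^bsub>A\<^esub>"
        using idx[of x] x by (simp add: h_def u_def)
      with hx show False by simp
    qed
    then obtain j where j: "j < n" "f (?s j) \<noteq> \<one>\<^bsub>A\<^esub> \<or> g (?s j) \<noteq> \<one>\<^bsub>A\<^esub>" by blast
    have "c [^]\<^bsub>B\<^esub> j \<otimes>\<^bsub>B\<^esub> ?s j = r x"
      using rc[OF x] by (simp add: B.m_assoc[symmetric])
    then have "x = inv\<^bsub>B\<^esub> (c [^]\<^bsub>B\<^esub> idx x) \<otimes>\<^bsub>B\<^esub> (c [^]\<^bsub>B\<^esub> j \<otimes>\<^bsub>B\<^esub> ?s j)"
      using xr[OF x] by simp
    then show "x \<in> ?T"
      using j idx[of x] rc[OF x] by (intro image_eqI[of _ _ "(idx x, j, ?s j)"]) auto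
  qed
  then have "finite {x \<in> carrier B. h x \<noteq> \<one>\<^bsub>A\<^esub>}"
    by (rule finite_subset) simp
  then have "(h, \<one>\<^bsub>B\<^esub>) \<in> carrier (A \<wreath> B)"
    using hA by (auto simp: carrier_wreath) (simp add: h_def)
  moreover have "(h, \<one>\<^bsub>B\<^esub>) \<otimes>\<^bsub>A \<wreath> B\<^esub> (f, c) = (g, c) \<otimes>\<^bsub>A \<wreath> B\<^esub> (h, \<one>\<^bsub>B\<^esub>)"
    using rec by (auto simp: mult_wreath)
  ultimately show ?thesis by blast
qed

end

section \<open>Homomorphisms between wreath products\<close>

text \<open>
  The \<open>p\<^sup>m\<close>-th power with \<open>p\<^sup>m\<close> an exponent of \<open>B\<close> lands in the base group, where powers are taken
  pointwise.
\<close>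

lemma finite_p_group_wreath:
  assumes "prime p" "finite_p_group p A" "finite_p_group p B"
  shows "finite_p_group p (A \<wreath> B)"
proof -
  interpret wreath_groups A B
    using assms by (auto simp: finite_p_group_def p_group_def wreath_groups_def)
  have fin: "finite (carrier A)" "finite (carrier B)"
    using assms by (auto simp: finite_p_group_def)
  have "carrier (A \<wreath> B) \<subseteq> (carrier B \<rightarrow>\<^sub>E carrier A) \<times> carrier B"
    using carrier_wreath by auto
  then have "finite (carrier (A \<wreath> B))"
    using fin by (meson finite_PiE finite_SigmaI finite_subset)
  moreover obtain k where k: "\<And>x. x \<in> carrier A \<Longrightarrow> x [^]\<^bsub>A\<^esub> (p ^ k) = \<one>\<^bsub>A\<^esub>"
    using finite_p_group_exponent assms by blast
  obtain m where m: "\<And>x. x \<in> carrier B \<Longrightarrow> x [^]\<^bsub>B\<^esub> (p ^ m) = \<one>\<^bsub>B\<^esub>"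
    using finite_p_group_exponent assms by blast
  have base: "(f, \<one>\<^bsub>B\<^esub>) [^]\<^bsub>A \<wreath> B\<^esub> n = (\<lambda>x \<in> carrier B. f x [^]\<^bsub>A\<^esub> n, \<one>\<^bsub>B\<^esub>)" for f and n :: nat
    by (induction n) (auto simp: one_wreath mult_wreath)
  have "(f, b) [^]\<^bsub>A \<wreath> B\<^esub> (p ^ (m + k)) = \<one>\<^bsub>A \<wreath> B\<^esub>" if fb: "(f, b) \<in> carrier (A \<wreath> B)" for f b
  proof -
    have "(f, b) [^]\<^bsub>A \<wreath> B\<^esub> (p ^ (m + k)) = ((f, b) [^]\<^bsub>A \<wreath> B\<^esub> (p ^ m)) [^]\<^bsub>A \<wreath> B\<^esub> (p ^ k)"
      using fb by (simp add: W.nat_pow_pow power_add)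
    also have "\<dots> = (orbit_prod f b (p ^ m), \<one>\<^bsub>B\<^esub>) [^]\<^bsub>A \<wreath> B\<^esub> (p ^ k)"
      using fb m wreath_closed(1)[OF fb] by (simp add: pow_eq_orbit_prod)
    also have "\<dots> = \<one>\<^bsub>A \<wreath> B\<^esub>"
      using k orbit_prod_closed(2)[OF fb] by (auto simp: base one_wreath)
    finally show ?thesis .
  qed
  ultimately show ?thesis
    using W.is_group by (auto simp: finite_p_group_def p_group_iff_pow[OF assms(1)])
qed

definition wreath_map :: "('b, 'm) monoid_scheme \<Rightarrow> ('a \<Rightarrow> 'c) \<Rightarrow> ('b \<Rightarrow> 'a) \<times> 'b \<Rightarrow> ('b \<Rightarrow> 'c) \<times> 'b" where
  "wreath_map B \<alpha> = (\<lambda>(f, b). (\<lambda>x \<in> carrier B. \<alpha> (f x), b))"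

lemma wreath_map_hom:
  assumes "group_hom A A' \<alpha>" "group B"
  shows "wreath_map B \<alpha> \<in> hom (A \<wreath> B) (A' \<wreath> B)"
proof -
  interpret \<alpha>: group_hom A A' \<alpha> by fact
  interpret AB: wreath_groups A B
    using assms by (simp add: wreath_groups_def)
  interpret A'B: wreath_groups A' B
    using assms by (simp add: wreath_groups_def)
  show ?thesis
  proof (rule homI)
    fix w assume "w \<in> carrier (A \<wreath> B)"
    moreover obtain f b where w: "w = (f, b)" by fastforce
    ultimately have fb: "(f, b) \<in> carrier (A \<wreath> B)" by simp
    have "{x \<in> carrier B. \<alpha> (f x) \<noteq> \<one>\<^bsub>A'\<^esub>} \<subseteq> {x \<in> carrier B. f x \<noteq> \<one>\<^bsub>A\<^esub>}"
      by auto
    then have "finite {x \<in> carrier B. \<alpha> (f x) \<noteq> \<one>\<^bsub>A'\<^esub>}"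
      using AB.wreath_closed(3)[OF fb] finite_subset by blast
    then show "wreath_map B \<alpha> w \<in> carrier (A' \<wreath> B)"
      using AB.wreath_closed[OF fb] unfolding w
      by (auto simp: wreath_map_def A'B.carrier_wreath cong: conj_cong)
  next
    fix w v assume "w \<in> carrier (A \<wreath> B)" "v \<in> carrier (A \<wreath> B)"
    moreover obtain f b g c where w: "w = (f, b)" "v = (g, c)" by fastforce
    ultimately have fb: "(f, b) \<in> carrier (A \<wreath> B)" and gc: "(g, c) \<in> carrier (A \<wreath> B)" by simp_all
    show "wreath_map B \<alpha> (w \<otimes>\<^bsub>A \<wreath> B\<^esub> v) = wreath_map B \<alpha> w \<otimes>\<^bsub>A' \<wreath> B\<^esub> wreath_map B \<alpha> v"
      using AB.wreath_closed[OF fb] AB.wreath_closed[OF gc] unfolding w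
      by (auto simp: wreath_map_def mult_wreath)
  qed
qed

text \<open>
  Multiplies the values of \<open>f\<close> along the fibres of \<open>\<beta>\<close>. The fibres may be infinite, and \<open>gfinprod\<close>
  restricts the product to the finite support.
\<close>

definition wreath_push :: "('a, 'k) monoid_scheme \<Rightarrow> ('b, 'm) monoid_scheme \<Rightarrow> ('c, 'l) monoid_scheme \<Rightarrow>
    ('b \<Rightarrow> 'c) \<Rightarrow> ('b \<Rightarrow> 'a) \<times> 'b \<Rightarrow> ('c \<Rightarrow> 'a) \<times> 'c" where
  "wreath_push A B Q \<beta> =
    (\<lambda>(f, b). (\<lambda>z \<in> carrier Q. gfinprod A f {x \<in> carrier B. \<beta> x = z}, \<beta> b))"

lemma (in comm_monoid) gfinprod_one_eqI:
  assumes "\<And>i. i \<in> I \<Longrightarrow> f i = \<one>"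
  shows "gfinprod G f I = \<one>"
proof -
  have eq: "{i \<in> I. f i \<noteq> \<one>} = {}"
    using assms by auto
  then show ?thesis
    unfolding gfinprod_def eq by simp
qed

lemma (in comm_monoid) gfinprod_reindex:
  assumes "inj_on s I" "f \<in> s ` I \<rightarrow> carrier G"
  shows "gfinprod G (\<lambda>i. f (s i)) I = gfinprod G f (s ` I)"
proof -
  let ?J = "{i \<in> I. f (s i) \<noteq> \<one>}"
  have img: "{x \<in> s ` I. f x \<noteq> \<one>} = s ` ?J" by auto
  have inj: "inj_on s ?J"
    using assms(1) by (auto simp: inj_on_def)
  then have "finprod G f (s ` ?J) = finprod G (\<lambda>i. f (s i)) ?J"
    by (intro finprod_reindex) (use assms(2) in auto)
  then show ?thesis
    unfolding gfinprod_def img by (simp add: finite_image_iff[OF inj])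
qed

text \<open>
  Commutativity of \<open>A\<close> is what makes fibrewise products multiplicative. Compatibility with the actions
  holds because translation by \<open>b\<^sup>-\<^sup>1\<close> maps the fibre over \<open>z\<close> bijectively to the one over \<open>\<beta> b\<^sup>-\<^sup>1 z\<close>.
\<close>

lemma wreath_push_hom:
  assumes "comm_group A" "group_hom B Q \<beta>"
  shows "wreath_push A B Q \<beta> \<in> hom (A \<wreath> B) (A \<wreath> Q)"
proof -
  interpret A: comm_group A by fact
  interpret \<beta>: group_hom B Q \<beta> by fact
  interpret AB: wreath_groups A B
    by (simp add: wreath_groups_def \<beta>.G.is_group A.is_group)
  interpret AQ: wreath_groups A Q
    by (simp add: wreath_groups_def \<beta>.H.is_group A.is_group)
  let ?fib = "\<lambda>z. {x \<in> carrier B. \<beta> x = z}"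
  show ?thesis
  proof (rule homI)
    fix w assume "w \<in> carrier (A \<wreath> B)"
    moreover obtain f b where w: "w = (f, b)" by fastforce
    ultimately have fb: "(f, b) \<in> carrier (A \<wreath> B)" by simp
    have "{z \<in> carrier Q. gfinprod A f (?fib z) \<noteq> \<one>\<^bsub>A\<^esub>} \<subseteq> \<beta> ` {x \<in> carrier B. f x \<noteq> \<one>\<^bsub>A\<^esub>}"
    proof
      fix z assume "z \<in> {z \<in> carrier Q. gfinprod A f (?fib z) \<noteq> \<one>\<^bsub>A\<^esub>}"
      then have "\<not> (\<forall>x \<in> ?fib z. f x = \<one>\<^bsub>A\<^esub>)"
        using A.gfinprod_one_eqI[of "?fib z" f] by auto
      then show "z \<in> \<beta> ` {x \<in> carrier B. f x \<noteq> \<one>\<^bsub>A\<^esub>}"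
        by auto
    qed
    then have "finite {z \<in> carrier Q. gfinprod A f (?fib z) \<noteq> \<one>\<^bsub>A\<^esub>}"
      using AB.wreath_closed(3)[OF fb] by (meson finite_imageI finite_subset)
    then show "wreath_push A B Q \<beta> w \<in> carrier (A \<wreath> Q)"
      using AB.wreath_closed[OF fb] unfolding w
      by (auto simp: wreath_push_def AQ.carrier_wreath intro!: A.gfinprod_closed cong: conj_cong)
  next
    fix w v assume "w \<in> carrier (A \<wreath> B)" "v \<in> carrier (A \<wreath> B)"
    moreover obtain f b g c where w: "w = (f, b)" "v = (g, c)" by fastforce
    ultimately have fb: "(f, b) \<in> carrier (A \<wreath> B)" and gc: "(g, c) \<in> carrier (A \<wreath> B)" by simp_all
    note [simp] = AB.wreath_closed[OF fb] AB.wreath_closed[OF gc]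
    have "gfinprod A (\<lambda>x \<in> carrier B. f x \<otimes>\<^bsub>A\<^esub> g (inv\<^bsub>B\<^esub> b \<otimes>\<^bsub>B\<^esub> x)) (?fib z) =
        gfinprod A f (?fib z) \<otimes>\<^bsub>A\<^esub> gfinprod A g (?fib (inv\<^bsub>Q\<^esub> \<beta> b \<otimes>\<^bsub>Q\<^esub> z))"
      if z: "z \<in> carrier Q" for z
    proof -
      let ?s = "\<lambda>x. inv\<^bsub>B\<^esub> b \<otimes>\<^bsub>B\<^esub> x"
      have bij: "?s ` ?fib z = ?fib (inv\<^bsub>Q\<^esub> \<beta> b \<otimes>\<^bsub>Q\<^esub> z)"
      proof (intro equalityI subsetI)
        fix y assume y: "y \<in> ?fib (inv\<^bsub>Q\<^esub> \<beta> b \<otimes>\<^bsub>Q\<^esub> z)"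
        then have "y = ?s (b \<otimes>\<^bsub>B\<^esub> y)" "b \<otimes>\<^bsub>B\<^esub> y \<in> ?fib z"
          using z by (simp_all add: \<beta>.G.m_assoc[symmetric] \<beta>.H.m_assoc[symmetric])
        then show "y \<in> ?s ` ?fib z" by blast
      qed auto
      have inj: "inj_on ?s (?fib z)"
        by (auto simp: inj_on_def)
      have supp: "finite {x \<in> ?fib z. f x \<noteq> \<one>\<^bsub>A\<^esub>}" "finite {x \<in> ?fib Y. g x \<noteq> \<one>\<^bsub>A\<^esub>}" for Y
        by (rule finite_subset[OF _ AB.wreath_closed(3)[OF fb]] finite_subset[OF _ AB.wreath_closed(3)[OF gc]], auto)+
      have "finite (?s ` {x \<in> ?fib z. g (?s x) \<noteq> \<one>\<^bsub>A\<^esub>})"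
        by (rule finite_subset[OF _ AB.wreath_closed(3)[OF gc]]) auto
      then have supp': "finite {x \<in> ?fib z. g (?s x) \<noteq> \<one>\<^bsub>A\<^esub>}"
        by (rule finite_imageD) (use inj in \<open>auto simp: inj_on_def\<close>)
      have "gfinprod A (\<lambda>x \<in> carrier B. f x \<otimes>\<^bsub>A\<^esub> g (?s x)) (?fib z) =
          gfinprod A (\<lambda>x. f x \<otimes>\<^bsub>A\<^esub> g (?s x)) (?fib z)"
        by (rule A.gfinprod_cong) (auto simp: simp_implies_def)
      also have "\<dots> = gfinprod A f (?fib z) \<otimes>\<^bsub>A\<^esub> gfinprod A (\<lambda>x. g (?s x)) (?fib z)"
        using supp supp' by (intro A.gfinprod_distrib) auto
      also have "gfinprod A (\<lambda>x. g (?s x)) (?fib z) = gfinprod A g (?s ` ?fib z)"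
        using inj by (intro A.gfinprod_reindex) auto
      finally show ?thesis unfolding bij .
    qed
    then show "wreath_push A B Q \<beta> (w \<otimes>\<^bsub>A \<wreath> B\<^esub> v) = wreath_push A B Q \<beta> w \<otimes>\<^bsub>A \<wreath> Q\<^esub> wreath_push A B Q \<beta> v"
      unfolding w by (auto simp: wreath_push_def mult_wreath)
  qed
qed

lemma wreath_push_apply:
  assumes "comm_group A" "group_hom B Q \<beta>" "(f, b) \<in> carrier (A \<wreath> B)" "x \<in> carrier B"
    and "\<And>y. y \<in> carrier B \<Longrightarrow> f y \<noteq> \<one>\<^bsub>A\<^esub> \<Longrightarrow> \<beta> y = \<beta> x \<Longrightarrow> y = x"
  shows "fst (wreath_push A B Q \<beta> (f, b)) (\<beta> x) = f x"
proof -
  interpret A: comm_group A by fact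
  interpret \<beta>: group_hom B Q \<beta> by fact
  interpret AB: wreath_groups A B
    by (simp add: wreath_groups_def \<beta>.G.is_group A.is_group)
  note [simp] = AB.wreath_closed[OF assms(3)]
  have "gfinprod A f {y \<in> carrier B. \<beta> y = \<beta> x} = gfinprod A f {x}"
    using assms by (intro A.gfinprod_mono_neutral_cong_right) auto
  also have "\<dots> = f x"
    using assms(4) by simp
  finally show ?thesis
    using assms(4) by (simp add: wreath_push_def)
qed

lemma wreath_push_neq_one:
  assumes "comm_group A" "z \<in> carrier Q" "fst (wreath_push A B Q \<beta> (f, b)) z \<noteq> \<one>\<^bsub>A\<^esub>"
  obtains x where "x \<in> carrier B" "f x \<noteq> \<one>\<^bsub>A\<^esub>" "\<beta> x = z"
proof -
  interpret A: comm_group A by fact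
  have "gfinprod A f {x \<in> carrier B. \<beta> x = z} \<noteq> \<one>\<^bsub>A\<^esub>"
    using assms(2,3) by (simp add: wreath_push_def)
  then show ?thesis
    using A.gfinprod_one_eqI[of "{x \<in> carrier B. \<beta> x = z}" f] that by auto
qed

section \<open>Separating conjugacy classes of wreath products\<close>

text \<open>
  The part of the argument that concerns conjugators in the base group. Different top components are
  separated by the projection to \<open>B\<close>. For equal ones, some pair of orbit products is not conjugate in
  \<open>A\<close>, and a finite \<open>p\<close>-quotient of \<open>A\<close> that keeps it so induces the required quotient of \<open>A \<wreath> B\<close>.
\<close>

lemma (in wreath_groups) base_conj_separated:
  assumes p: "prime p" and A: "p_conj_separable p A" and B: "finite_p_group p B"
    and f: "(f, b) \<in> carrier (A \<wreath> B)" and g: "(g, c) \<in> carrier (A \<wreath> B)"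
    and nc: "\<And>h. (h, \<one>\<^bsub>B\<^esub>) \<in> carrier (A \<wreath> B) \<Longrightarrow>
      (h, \<one>\<^bsub>B\<^esub>) \<otimes>\<^bsub>A \<wreath> B\<^esub> (f, b) \<noteq> (g, c) \<otimes>\<^bsub>A \<wreath> B\<^esub> (h, \<one>\<^bsub>B\<^esub>)"
  shows "\<exists>N. p_open p (A \<wreath> B) N \<and> (\<forall>h. (h, \<one>\<^bsub>B\<^esub>) \<in> carrier (A \<wreath> B) \<longrightarrow>
    (h, \<one>\<^bsub>B\<^esub>) \<otimes>\<^bsub>A \<wreath> B\<^esub> (f, b) \<otimes>\<^bsub>A \<wreath> B\<^esub> inv\<^bsub>A \<wreath> B\<^esub> (h, \<one>\<^bsub>B\<^esub>) \<otimes>\<^bsub>A \<wreath> B\<^esub> inv\<^bsub>A \<wreath> B\<^esub> (g, c) \<notin> N)"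
proof (cases "b = c")
  case False
  interpret snd: group_hom "A \<wreath> B" B snd
    using snd_hom by unfold_locales
  have "p_open p (A \<wreath> B) (kernel (A \<wreath> B) B snd)"
    using p_open_kernel[OF p B snd_hom] .
  then show ?thesis
    using False f g wreath_closed(1)[OF f] wreath_closed(1)[OF g]
    by (intro exI[of _ "kernel (A \<wreath> B) B snd"]) (simp add: snd.conj_in_kernel_coset_iff)
next
  case True
  define n where "n = B.ord c"
  have c: "c \<in> carrier B" and fc: "(f, c) \<in> carrier (A \<wreath> B)"
    using wreath_closed(1)[OF g] f True by simp_all
  have "n > 0"
    using B c p by (auto simp: finite_p_group_def p_group_def n_def prime_gt_0_nat)
  then have "\<not> (\<forall>x \<in> carrier B. conj_in A (orbit_prod f c n x) (orbit_prod g c n x))"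
    using conj_by_base_if_orbit_prods_conj[OF fc g, of n] nc True n_def by auto
  then obtain x where x: "x \<in> carrier B" "\<not> conj_in A (orbit_prod f c n x) (orbit_prod g c n x)"
    by blast
  note F = orbit_prod_closed[OF fc, where n = n] and G = orbit_prod_closed[OF g, where n = n]
  obtain M where M: "p_open p A M"
    "\<And>a. a \<in> carrier A \<Longrightarrow> a \<otimes>\<^bsub>A\<^esub> orbit_prod f c n x \<otimes>\<^bsub>A\<^esub> inv\<^bsub>A\<^esub> a \<otimes>\<^bsub>A\<^esub> inv\<^bsub>A\<^esub> orbit_prod g c n x \<notin> M"
    using p_conj_separable_iff[OF p A.is_group] A x F(2) G(2) unfolding p_separated_def by blast
  obtain Q :: "nat monoid" and \<alpha> where Q: "finite_p_group p Q" "group_hom A Q \<alpha>" "M = kernel A Q \<alpha>"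
    using p_openE[OF M(1) A.is_group] by blast
  interpret \<alpha>: group_hom A Q \<alpha> by fact
  interpret Q: wreath_groups Q B
    by (simp add: wreath_groups_def B.is_group \<alpha>.H.is_group)
  let ?\<phi> = "wreath_map B \<alpha>"
  interpret \<phi>: group_hom "A \<wreath> B" "Q \<wreath> B" ?\<phi>
    using wreath_map_hom[OF Q(2) B.is_group] by unfold_locales
  let ?f = "\<lambda>h. \<lambda>x \<in> carrier B. \<alpha> (h x)"
  have img: "?\<phi> (h, d) = (?f h, d)" for h d
    by (simp add: wreath_map_def)
  have img_prod: "Q.orbit_prod (?f h) c n x = \<alpha> (orbit_prod h c n x)"
    if "(h, c) \<in> carrier (A \<wreath> B)" for h
  proof -
    have "(?f (orbit_prod h c n), c [^]\<^bsub>B\<^esub> n) = (?f h, c) [^]\<^bsub>Q \<wreath> B\<^esub> n"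
      using \<phi>.hom_nat_pow[OF that, of n] by (simp only: pow_eq_orbit_prod[OF that] img)
    from this[symmetric] have "Q.orbit_prod (?f h) c n = ?f (orbit_prod h c n)"
      by (simp add: Q.orbit_prod_def)
    then show ?thesis using x(1) by simp
  qed
  have "p_open p (A \<wreath> B) (kernel (A \<wreath> B) (Q \<wreath> B) ?\<phi>)"
    using p_open_kernel[OF p finite_p_group_wreath[OF p Q(1) B] \<phi>.homh] .
  moreover have "(h, \<one>\<^bsub>B\<^esub>) \<otimes>\<^bsub>A \<wreath> B\<^esub> (f, b) \<otimes>\<^bsub>A \<wreath> B\<^esub> inv\<^bsub>A \<wreath> B\<^esub> (h, \<one>\<^bsub>B\<^esub>) \<otimes>\<^bsub>A \<wreath> B\<^esub> inv\<^bsub>A \<wreath> B\<^esub> (g, c)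
      \<notin> kernel (A \<wreath> B) (Q \<wreath> B) ?\<phi>" (is "?w \<notin> _")
    if h: "(h, \<one>\<^bsub>B\<^esub>) \<in> carrier (A \<wreath> B)" for h
  proof
    assume "?w \<in> kernel (A \<wreath> B) (Q \<wreath> B) ?\<phi>"
    then have "(?f h, \<one>\<^bsub>B\<^esub>) \<otimes>\<^bsub>Q \<wreath> B\<^esub> (?f f, c) = (?f g, c) \<otimes>\<^bsub>Q \<wreath> B\<^esub> (?f h, \<one>\<^bsub>B\<^esub>)"
      using \<phi>.conj_in_kernel_coset_iff[OF h f g] True by (simp add: img)
    moreover have "(?f f, c) \<in> carrier (Q \<wreath> B)" "(?f g, c) \<in> carrier (Q \<wreath> B)"
        "(?f h, \<one>\<^bsub>B\<^esub>) \<in> carrier (Q \<wreath> B)"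
      using \<phi>.hom_closed[OF fc] \<phi>.hom_closed[OF g] \<phi>.hom_closed[OF h] by (simp_all add: img)
    moreover have "c [^]\<^bsub>B\<^esub> n = \<one>\<^bsub>B\<^esub>"
      using c by (simp add: n_def)
    ultimately have "?f h x \<otimes>\<^bsub>Q\<^esub> Q.orbit_prod (?f f) c n (inv\<^bsub>B\<^esub> \<one>\<^bsub>B\<^esub> \<otimes>\<^bsub>B\<^esub> x) =
        Q.orbit_prod (?f g) c n x \<otimes>\<^bsub>Q\<^esub> ?f h x"
      using x(1) by (intro Q.orbit_prod_conj)
    then have "\<alpha> (h x) \<otimes>\<^bsub>Q\<^esub> \<alpha> (orbit_prod f c n x) = \<alpha> (orbit_prod g c n x) \<otimes>\<^bsub>Q\<^esub> \<alpha> (h x)"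
      using x(1) img_prod[OF fc] img_prod[OF g] by simp
    then show False
      using M(2)[of "h x"] wreath_closed(2)[OF h] x(1) F(2) G(2)
      by (simp add: Q(3) \<alpha>.conj_in_kernel_coset_iff)
  qed
  ultimately show ?thesis by blast
qed

text \<open>
  A conjugator \<open>(h, d)\<close> is a base element times \<open>d\<close>, so conjugating by it amounts to conjugating first by
  \<open>d\<close> and then within the base group. As \<open>B\<close> is finite, the open subgroups found for
  the individual \<open>d\<close> may be intersected.
\<close>

theorem p_conj_separable_wreath_finite:
  assumes p: "prime p" and A: "p_conj_separable p A" and B: "finite_p_group p B"
  shows "p_conj_separable p (A \<wreath> B)"
proof -
  interpret wreath_groups A B
    using A B by (simp add: wreath_groups_def p_conj_separable_def finite_p_group_def p_group_def)
  let ?W = "A \<wreath> B"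
  let ?t = "\<lambda>d. (\<lambda>x \<in> carrier B. \<one>\<^bsub>A\<^esub>, d)"
  have "p_separated p ?W w v"
    if w: "w \<in> carrier ?W" and v: "v \<in> carrier ?W" and nc: "\<not> conj_in ?W w v" for w v
  proof -
    let ?w = "\<lambda>d. ?t d \<otimes>\<^bsub>?W\<^esub> w \<otimes>\<^bsub>?W\<^esub> inv\<^bsub>?W\<^esub> ?t d"
    let ?P = "\<lambda>N d. p_open p ?W N \<and> (\<forall>h. (h, \<one>\<^bsub>B\<^esub>) \<in> carrier ?W \<longrightarrow>
      (h, \<one>\<^bsub>B\<^esub>) \<otimes>\<^bsub>?W\<^esub> ?w d \<otimes>\<^bsub>?W\<^esub> inv\<^bsub>?W\<^esub> (h, \<one>\<^bsub>B\<^esub>) \<otimes>\<^bsub>?W\<^esub> inv\<^bsub>?W\<^esub> v \<notin> N)"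
    have "\<exists>N. ?P N d" if d: "d \<in> carrier B" for d
    proof -
      have t: "?t d \<in> carrier ?W"
        using top_closed[OF d] .
      have "(h, \<one>\<^bsub>B\<^esub>) \<otimes>\<^bsub>?W\<^esub> ?w d \<noteq> v \<otimes>\<^bsub>?W\<^esub> (h, \<one>\<^bsub>B\<^esub>)" if h: "(h, \<one>\<^bsub>B\<^esub>) \<in> carrier ?W" for h
      proof
        assume eq: "(h, \<one>\<^bsub>B\<^esub>) \<otimes>\<^bsub>?W\<^esub> ?w d = v \<otimes>\<^bsub>?W\<^esub> (h, \<one>\<^bsub>B\<^esub>)"
        have "(h, \<one>\<^bsub>B\<^esub>) \<otimes>\<^bsub>?W\<^esub> ?t d \<otimes>\<^bsub>?W\<^esub> w = (h, \<one>\<^bsub>B\<^esub>) \<otimes>\<^bsub>?W\<^esub> ?w d \<otimes>\<^bsub>?W\<^esub> ?t d"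
          using h t w by (simp add: W.m_assoc)
        also have "\<dots> = v \<otimes>\<^bsub>?W\<^esub> ((h, \<one>\<^bsub>B\<^esub>) \<otimes>\<^bsub>?W\<^esub> ?t d)"
          unfolding eq using h t v by (simp add: W.m_assoc)
        finally show False
          using nc h t w v by (auto simp: W.conj_in_iff_commute)
      qed
      moreover have "?w d \<in> carrier ?W"
        using t w by simp
      ultimately show ?thesis
        using base_conj_separated[OF p A B, of "fst (?w d)" "snd (?w d)" "fst v" "snd v"] v by simp
    qed
    then obtain N where N: "\<And>d. d \<in> carrier B \<Longrightarrow> ?P (N d) d"
      by metis
    have "p_open p ?W {x \<in> carrier ?W. \<forall>d \<in> carrier B. x \<in> N d}"
      using N B by (intro p_open_INT[OF p W.is_group]) (auto simp: finite_p_group_def)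
    moreover have "\<exists>d \<in> carrier B. y \<otimes>\<^bsub>?W\<^esub> w \<otimes>\<^bsub>?W\<^esub> inv\<^bsub>?W\<^esub> y \<otimes>\<^bsub>?W\<^esub> inv\<^bsub>?W\<^esub> v \<notin> N d"
      if y: "y \<in> carrier ?W" for y
    proof -
      obtain h d where hd: "y = (h, d)" by fastforce
      then have h: "(h, \<one>\<^bsub>B\<^esub>) \<in> carrier ?W" and d: "d \<in> carrier B"
        and split: "y = (h, \<one>\<^bsub>B\<^esub>) \<otimes>\<^bsub>?W\<^esub> ?t d"
        using base_eq_top_mult[of h d] y wreath_closed(1)[of h d] by auto
      note t = top_closed[OF d]
      have "y \<otimes>\<^bsub>?W\<^esub> w \<otimes>\<^bsub>?W\<^esub> inv\<^bsub>?W\<^esub> y = (h, \<one>\<^bsub>B\<^esub>) \<otimes>\<^bsub>?W\<^esub> ?w d \<otimes>\<^bsub>?W\<^esub> inv\<^bsub>?W\<^esub> (h, \<one>\<^bsub>B\<^esub>)"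
        unfolding split using h t w by (simp add: W.inv_mult_group W.m_assoc)
      then show ?thesis
        using N[OF d] h d by (intro bexI[of _ d]) simp_all
    qed
    ultimately show ?thesis
      unfolding p_separated_def
      by (intro exI[of _ "{x \<in> carrier ?W. \<forall>d \<in> carrier B. x \<in> N d}"]) auto
  qed
  then show ?thesis
    by (simp add: p_conj_separable_iff[OF p W.is_group])
qed

lemma (in group) p_separated_conj:
  assumes "t \<in> carrier G" "g \<in> carrier G" "h \<in> carrier G" "p_separated p G (t \<otimes> g \<otimes> inv t) h"
  shows "p_separated p G g h"
proof -
  obtain N where N: "p_open p G N"
    "\<And>x. x \<in> carrier G \<Longrightarrow> x \<otimes> (t \<otimes> g \<otimes> inv t) \<otimes> inv x \<otimes> inv h \<notin> N"
    using assms(4) unfolding p_separated_def by blast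
  have "x \<otimes> g \<otimes> inv x \<otimes> inv h \<notin> N" if x: "x \<in> carrier G" for x
  proof -
    have cancel: "inv t \<otimes> (t \<otimes> y) = y" if "y \<in> carrier G" for y
      using that assms(1) by (simp add: m_assoc[symmetric])
    have "(x \<otimes> inv t) \<otimes> (t \<otimes> g \<otimes> inv t) \<otimes> inv (x \<otimes> inv t) = x \<otimes> g \<otimes> inv x"
      using x assms(1,2) by (simp add: inv_mult_group m_assoc cancel)
    then show ?thesis
      using N(2)[of "x \<otimes> inv t"] x assms(1-3) by simp
  qed
  then show ?thesis
    unfolding p_separated_def using N(1) by blast
qed

text \<open>
  Conjugation by \<open>d\<close> in the centraliser of \<open>c\<close> translates the orbit products and keeps \<open>c\<close>, after which
  they coincide and a base element finishes the conjugation.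
\<close>

lemma (in wreath_groups) conj_if_orbit_prods_translate:
  assumes A: "comm_group A"
    and f: "(f, c) \<in> carrier (A \<wreath> B)" and g: "(g, c) \<in> carrier (A \<wreath> B)"
    and n: "B.ord c = n" "n > 0"
    and d: "d \<in> carrier B" "d \<otimes>\<^bsub>B\<^esub> c = c \<otimes>\<^bsub>B\<^esub> d"
    and eq: "\<And>x. x \<in> carrier B \<Longrightarrow> orbit_prod f c n (inv\<^bsub>B\<^esub> d \<otimes>\<^bsub>B\<^esub> x) = orbit_prod g c n x"
  shows "conj_in (A \<wreath> B) (f, c) (g, c)"
proof -
  interpret A: comm_group A by fact
  let ?t = "(\<lambda>x \<in> carrier B. \<one>\<^bsub>A\<^esub>, d)"
  note c = wreath_closed(1)[OF f]
  have t: "?t \<in> carrier (A \<wreath> B)"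
    using top_closed[OF d(1)] .
  define w where "w = ?t \<otimes>\<^bsub>A \<wreath> B\<^esub> (f, c) \<otimes>\<^bsub>A \<wreath> B\<^esub> inv\<^bsub>A \<wreath> B\<^esub> ?t"
  have wW: "w \<in> carrier (A \<wreath> B)"
    using t f by (simp add: w_def)
  have tw: "?t \<otimes>\<^bsub>A \<wreath> B\<^esub> (f, c) = w \<otimes>\<^bsub>A \<wreath> B\<^esub> ?t"
    using t f by (simp add: w_def W.m_assoc)
  interpret snd: group_hom "A \<wreath> B" B snd
    using snd_hom by unfold_locales
  have "snd w = d \<otimes>\<^bsub>B\<^esub> c \<otimes>\<^bsub>B\<^esub> inv\<^bsub>B\<^esub> d"
    using t f by (simp add: w_def)
  also have "\<dots> = c"
    using d c by (simp add: B.m_assoc)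
  finally obtain f' where w: "w = (f', c)"
    by (metis prod.collapse)
  note f' = wW[unfolded w]
  have "orbit_prod f' c n x = orbit_prod g c n x" if x: "x \<in> carrier B" for x
  proof -
    have "(\<lambda>x \<in> carrier B. \<one>\<^bsub>A\<^esub>) x \<otimes>\<^bsub>A\<^esub> orbit_prod f c n (inv\<^bsub>B\<^esub> d \<otimes>\<^bsub>B\<^esub> x) =
        orbit_prod f' c n x \<otimes>\<^bsub>A\<^esub> (\<lambda>x \<in> carrier B. \<one>\<^bsub>A\<^esub>) x"
      using x c n by (intro orbit_prod_conj f f' t tw[unfolded w]) (use B.pow_ord_eq_1[of c] in auto)
    then show ?thesis
      using x d eq[OF x] orbit_prod_closed(2)[OF f'] orbit_prod_closed(2)[OF g] by simp
  qed
  then have "conj_in A (orbit_prod f' c n x) (orbit_prod g c n x)" if "x \<in> carrier B" for x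
    using that orbit_prod_closed(2)[OF g that] by (auto simp: A.conj_in_iff_commute)
  from conj_by_base_if_orbit_prods_conj[OF f' g n this]
  obtain h where h: "(h, \<one>\<^bsub>B\<^esub>) \<in> carrier (A \<wreath> B)"
    "(h, \<one>\<^bsub>B\<^esub>) \<otimes>\<^bsub>A \<wreath> B\<^esub> w = (g, c) \<otimes>\<^bsub>A \<wreath> B\<^esub> (h, \<one>\<^bsub>B\<^esub>)"
    unfolding w by blast
  have "(h, \<one>\<^bsub>B\<^esub>) \<otimes>\<^bsub>A \<wreath> B\<^esub> ?t \<otimes>\<^bsub>A \<wreath> B\<^esub> (f, c) = (h, \<one>\<^bsub>B\<^esub>) \<otimes>\<^bsub>A \<wreath> B\<^esub> w \<otimes>\<^bsub>A \<wreath> B\<^esub> ?t"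
    using h(1) t f wW tw by (simp add: W.m_assoc)
  also have "\<dots> = (g, c) \<otimes>\<^bsub>A \<wreath> B\<^esub> ((h, \<one>\<^bsub>B\<^esub>) \<otimes>\<^bsub>A \<wreath> B\<^esub> ?t)"
    unfolding h(2) using h(1) t g by (simp add: W.m_assoc)
  finally show ?thesis
    using h(1) t f g by (auto simp: W.conj_in_iff_commute)
qed

text \<open>
  Write \<open>F\<close> and \<open>G\<close> for the full orbit products of \<open>f\<close> and \<open>g\<close>. In \<open>A \<wreath> Q\<close> a conjugator with top
  component \<open>\<delta>\<close> forces \<open>\<delta>\<close> to commute with \<open>\<beta> c\<close> and to translate the image of \<open>F\<close> to the image of
  \<open>G\<close>. If \<open>\<beta>\<close> is injective on the supports \<open>S\<close> and \<open>T\<close>, then \<open>\<delta>\<close> maps the image of a point of \<open>S\<close> to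
  that of a point of \<open>T\<close>, and so it is the image of one of the finitely many quotients \<open>t s\<^sup>-\<^sup>1\<close>. By
  nonconjugacy each of these either fails to commute with \<open>c\<close> or fails to translate \<open>F\<close> to \<open>G\<close> at some
  witness; injectivity of \<open>\<beta>\<close> on finitely many further points preserves both kinds of failure.
\<close>

lemma (in wreath_groups) nonconj_in_finite_top_quotient:
  assumes p: "prime p" and A: "comm_group A" and B: "p_conj_separable p B" "p_group p B"
    and f: "(f, c) \<in> carrier (A \<wreath> B)" and g: "(g, c) \<in> carrier (A \<wreath> B)"
    and nc: "\<not> conj_in (A \<wreath> B) (f, c) (g, c)"
  obtains Q :: "nat monoid" and \<beta> where "finite_p_group p Q" "group_hom B Q \<beta>"
    "\<not> conj_in (A \<wreath> Q) (wreath_push A B Q \<beta> (f, c)) (wreath_push A B Q \<beta> (g, c))"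
proof -
  interpret A: comm_group A by fact
  note c = wreath_closed(1)[OF f]
  define n where "n = B.ord c"
  have n: "n > 0" "c [^]\<^bsub>B\<^esub> n = \<one>\<^bsub>B\<^esub>"
    using B(2) c p by (auto simp: p_group_def n_def prime_gt_0_nat)
  define F where "F = orbit_prod f c n"
  define G where "G = orbit_prod g c n"
  have F: "(F, \<one>\<^bsub>B\<^esub>) \<in> carrier (A \<wreath> B)" and G: "(G, \<one>\<^bsub>B\<^esub>) \<in> carrier (A \<wreath> B)"
    using orbit_prod_closed(1)[OF f, of n] orbit_prod_closed(1)[OF g, of n] n(2)
    by (simp_all add: F_def G_def)
  define S where "S = {x \<in> carrier B. F x \<noteq> \<one>\<^bsub>A\<^esub>}"
  define T where "T = {x \<in> carrier B. G x \<noteq> \<one>\<^bsub>A\<^esub>}"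
  \<comment> \<open>The identity is included for the case that \<open>S\<close> is empty.\<close>
  define D where "D = insert \<one>\<^bsub>B\<^esub> ((\<lambda>(s, t). t \<otimes>\<^bsub>B\<^esub> inv\<^bsub>B\<^esub> s) ` (S \<times> T))"
  have fin: "finite S" "finite T" "finite D"
    using wreath_closed(3)[OF F] wreath_closed(3)[OF G] by (simp_all add: S_def T_def D_def)
  have sub: "S \<subseteq> carrier B" "T \<subseteq> carrier B" "D \<subseteq> carrier B"
    by (auto simp: S_def T_def D_def)
  have "\<forall>d \<in> D. \<exists>x \<in> carrier B. d \<otimes>\<^bsub>B\<^esub> c = c \<otimes>\<^bsub>B\<^esub> d \<longrightarrow> F (inv\<^bsub>B\<^esub> d \<otimes>\<^bsub>B\<^esub> x) \<noteq> G x"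
    using conj_if_orbit_prods_translate[OF A f g _ n(1)] nc sub(3)
    unfolding n_def F_def G_def by blast
  then obtain wit where wit: "\<And>d. d \<in> D \<Longrightarrow> wit d \<in> carrier B"
    "\<And>d. d \<in> D \<Longrightarrow> d \<otimes>\<^bsub>B\<^esub> c = c \<otimes>\<^bsub>B\<^esub> d \<Longrightarrow> F (inv\<^bsub>B\<^esub> d \<otimes>\<^bsub>B\<^esub> wit d) \<noteq> G (wit d)"
    by metis
  define Z where "Z = S \<union> T \<union> (\<lambda>d. d \<otimes>\<^bsub>B\<^esub> c) ` D \<union> (\<lambda>d. c \<otimes>\<^bsub>B\<^esub> d) ` D \<union> wit ` D \<union>
    (\<lambda>d. inv\<^bsub>B\<^esub> d \<otimes>\<^bsub>B\<^esub> wit d) ` D"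
  have "finite Z" "Z \<subseteq> carrier B"
    using fin sub c wit(1) by (auto simp: Z_def)
  then obtain Q :: "nat monoid" and \<beta> where Q: "finite_p_group p Q" "group_hom B Q \<beta>" "inj_on \<beta> Z"
    using p_conj_separable_inj_on[OF p B(1)] by blast
  interpret \<beta>: group_hom B Q \<beta> by fact
  interpret Q: wreath_groups A Q
    by (simp add: wreath_groups_def A.is_group \<beta>.H.is_group)
  let ?\<phi> = "wreath_push A B Q \<beta>"
  interpret \<phi>: group_hom "A \<wreath> B" "A \<wreath> Q" ?\<phi>
    using wreath_push_hom[OF A Q(2)] by unfold_locales
  define push where "push h = fst (?\<phi> (h, \<one>\<^bsub>B\<^esub>))" for h
  have push: "?\<phi> (h, d) = (push h, \<beta> d)" for h d
    by (simp add: wreath_push_def push_def)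
  have push_F: "push F (\<beta> x) = F x" if "x \<in> Z" for x
    unfolding push_def
  proof (rule wreath_push_apply[OF A Q(2) F])
    show "x \<in> carrier B" using that \<open>Z \<subseteq> carrier B\<close> by blast
    show "y = x" if "y \<in> carrier B" "F y \<noteq> \<one>\<^bsub>A\<^esub>" "\<beta> y = \<beta> x" for y
      using inj_onD[OF Q(3) that(3)] that(1,2) \<open>x \<in> Z\<close> by (simp add: Z_def S_def)
  qed
  have push_G: "push G (\<beta> x) = G x" if "x \<in> Z" for x
    unfolding push_def
  proof (rule wreath_push_apply[OF A Q(2) G])
    show "x \<in> carrier B" using that \<open>Z \<subseteq> carrier B\<close> by blast
    show "y = x" if "y \<in> carrier B" "G y \<noteq> \<one>\<^bsub>A\<^esub>" "\<beta> y = \<beta> x" for y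
      using inj_onD[OF Q(3) that(3)] that(1,2) \<open>x \<in> Z\<close> by (simp add: Z_def T_def)
  qed
  have orbit_push: "Q.orbit_prod (push h) (\<beta> c) n = push (orbit_prod h c n)"
    if "(h, c) \<in> carrier (A \<wreath> B)" for h
    using \<phi>.hom_nat_pow[OF that, of n]
    by (simp add: Q.orbit_prod_def pow_eq_orbit_prod[OF that] push prod_eq_iff)
  have "\<not> conj_in (A \<wreath> Q) (?\<phi> (f, c)) (?\<phi> (g, c))"
  proof
    assume "conj_in (A \<wreath> Q) (?\<phi> (f, c)) (?\<phi> (g, c))"
    then obtain h \<delta> where h: "(h, \<delta>) \<in> carrier (A \<wreath> Q)"
      and conj: "(h, \<delta>) \<otimes>\<^bsub>A \<wreath> Q\<^esub> (push f, \<beta> c) = (push g, \<beta> c) \<otimes>\<^bsub>A \<wreath> Q\<^esub> (h, \<delta>)"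
      using f g by (auto simp: Q.W.conj_in_iff_commute push[symmetric])
    have pf: "(push f, \<beta> c) \<in> carrier (A \<wreath> Q)" and pg: "(push g, \<beta> c) \<in> carrier (A \<wreath> Q)"
      using \<phi>.hom_closed[OF f] \<phi>.hom_closed[OF g] by (simp_all add: push)
    note \<delta> = Q.wreath_closed(1)[OF h]
    have comm: "\<delta> \<otimes>\<^bsub>Q\<^esub> \<beta> c = \<beta> c \<otimes>\<^bsub>Q\<^esub> \<delta>"
      using conj by (simp add: mult_wreath)
    have \<beta>c: "\<beta> c [^]\<^bsub>Q\<^esub> n = \<one>\<^bsub>Q\<^esub>"
      using \<beta>.hom_nat_pow[OF c, of n] n(2) by simp
    have trans: "push F (inv\<^bsub>Q\<^esub> \<delta> \<otimes>\<^bsub>Q\<^esub> z) = push G z" if z: "z \<in> carrier Q" for z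
    proof -
      have closed: "push F z \<in> carrier A" "push G z \<in> carrier A" if "z \<in> carrier Q" for z
        using Q.orbit_prod_closed(2)[OF pf that, of n] Q.orbit_prod_closed(2)[OF pg that, of n]
          orbit_push[OF f] orbit_push[OF g] by (simp_all add: F_def G_def)
      have "h z \<otimes>\<^bsub>A\<^esub> push F (inv\<^bsub>Q\<^esub> \<delta> \<otimes>\<^bsub>Q\<^esub> z) = push G z \<otimes>\<^bsub>A\<^esub> h z"
        using Q.orbit_prod_conj[OF pf pg h conj \<beta>c z] orbit_push[OF f] orbit_push[OF g]
        by (simp add: F_def G_def)
      then have "h z \<otimes>\<^bsub>A\<^esub> push F (inv\<^bsub>Q\<^esub> \<delta> \<otimes>\<^bsub>Q\<^esub> z) = h z \<otimes>\<^bsub>A\<^esub> push G z"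
        using closed z \<delta> Q.wreath_closed(2)[OF h] by (simp add: A.m_comm)
      then show ?thesis
        using closed z \<delta> Q.wreath_closed(2)[OF h] by simp
    qed
    have "\<exists>d \<in> D. (\<forall>x \<in> carrier B. push F (\<beta> (inv\<^bsub>B\<^esub> d \<otimes>\<^bsub>B\<^esub> x)) = push G (\<beta> x)) \<and>
        d \<otimes>\<^bsub>B\<^esub> c = c \<otimes>\<^bsub>B\<^esub> d"
    proof (cases "S = {}")
      case True
      have one: "push F z = \<one>\<^bsub>A\<^esub>" if z: "z \<in> carrier Q" for z
      proof (rule ccontr)
        assume "push F z \<noteq> \<one>\<^bsub>A\<^esub>"
        then obtain x where "x \<in> carrier B" "F x \<noteq> \<one>\<^bsub>A\<^esub>" "\<beta> x = z"
          unfolding push_def by (rule wreath_push_neq_one[OF A z])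
        then show False using True by (auto simp: S_def)
      qed
      then have "push G z = \<one>\<^bsub>A\<^esub>" if "z \<in> carrier Q" for z
        using trans[OF that] that \<delta> by simp
      then show ?thesis
        using one c by (intro bexI[of _ "\<one>\<^bsub>B\<^esub>"]) (auto simp: D_def)
    next
      case False
      then obtain s where s: "s \<in> S" by blast
      then have sB: "s \<in> carrier B" and "push F (\<beta> s) \<noteq> \<one>\<^bsub>A\<^esub>"
        using push_F[of s] by (auto simp: Z_def S_def)
      then have "push G (\<delta> \<otimes>\<^bsub>Q\<^esub> \<beta> s) \<noteq> \<one>\<^bsub>A\<^esub>"
        using trans[of "\<delta> \<otimes>\<^bsub>Q\<^esub> \<beta> s"] \<delta> by (simp add: \<beta>.H.m_assoc[symmetric])
      moreover have "\<delta> \<otimes>\<^bsub>Q\<^esub> \<beta> s \<in> carrier Q"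
        using \<delta> sB by simp
      ultimately obtain t where "t \<in> carrier B" "G t \<noteq> \<one>\<^bsub>A\<^esub>" and \<beta>t: "\<beta> t = \<delta> \<otimes>\<^bsub>Q\<^esub> \<beta> s"
        unfolding push_def by (metis wreath_push_neq_one[OF A])
      then have t: "t \<in> T" by (simp add: T_def)
      let ?d = "t \<otimes>\<^bsub>B\<^esub> inv\<^bsub>B\<^esub> s"
      have d: "?d \<in> D" "?d \<in> carrier B"
        using s t sub by (auto simp: D_def)
      have \<beta>d: "\<beta> ?d = \<delta>"
        using \<beta>t \<delta> sB t sub(2) by (simp add: \<beta>.H.m_assoc subset_iff)
      have "push F (\<beta> (inv\<^bsub>B\<^esub> ?d \<otimes>\<^bsub>B\<^esub> x)) = push G (\<beta> x)" if "x \<in> carrier B" for x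
        using trans[of "\<beta> x"] that d(2) \<beta>d by simp
      moreover have "\<beta> (?d \<otimes>\<^bsub>B\<^esub> c) = \<beta> (c \<otimes>\<^bsub>B\<^esub> ?d)"
        using comm \<beta>d d(2) c by simp
      then have "?d \<otimes>\<^bsub>B\<^esub> c = c \<otimes>\<^bsub>B\<^esub> ?d"
        by (rule inj_onD[OF Q(3)]) (use d(1) in \<open>auto simp: Z_def\<close>)
      ultimately show ?thesis using d(1) by blast
    qed
    then obtain d where d: "d \<in> D" "d \<otimes>\<^bsub>B\<^esub> c = c \<otimes>\<^bsub>B\<^esub> d"
      "\<And>x. x \<in> carrier B \<Longrightarrow> push F (\<beta> (inv\<^bsub>B\<^esub> d \<otimes>\<^bsub>B\<^esub> x)) = push G (\<beta> x)"
      by blast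
    have "wit d \<in> Z" "inv\<^bsub>B\<^esub> d \<otimes>\<^bsub>B\<^esub> wit d \<in> Z"
      using d(1) by (auto simp: Z_def)
    then show False
      using d(3)[OF wit(1)[OF d(1)]] wit(2)[OF d(1,2)] by (simp only: push_F push_G)
  qed
  with Q(1,2) show ?thesis by (rule that)
qed

text \<open>
  Elements whose top components are not conjugate in \<open>B\<close> are separated there; otherwise a conjugation
  makes the top components equal, and the quotient \<open>A \<wreath> Q\<close> just constructed is covered by the case
  of a finite acting group.
\<close>

theorem p_conj_separable_wreath_abelian:
  assumes p: "prime p" and A: "comm_group A" "p_conj_separable p A"
    and B: "p_conj_separable p B" "p_group p B"
  shows "p_conj_separable p (A \<wreath> B)"
proof -
  interpret wreath_groups A B
    using A B by (simp add: wreath_groups_def p_conj_separable_def)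
  let ?W = "A \<wreath> B"
  interpret snd: group_hom ?W B snd
    using snd_hom by unfold_locales
  have "p_separated p ?W w v"
    if w: "w \<in> carrier ?W" and v: "v \<in> carrier ?W" and nc: "\<not> conj_in ?W w v" for w v
  proof (cases "conj_in B (snd w) (snd v)")
    case False
    then have "p_separated p B (snd w) (snd v)"
      using p_conj_separable_iff[OF p B.is_group] B(1) w v by auto
    then show ?thesis
      using p_separated_vimage[OF W.is_group B.is_group snd_hom w v] by blast
  next
    case True
    then obtain d where d: "d \<in> carrier B" "snd v = d \<otimes>\<^bsub>B\<^esub> snd w \<otimes>\<^bsub>B\<^esub> inv\<^bsub>B\<^esub> d"
      by (auto simp: conj_in_def)
    let ?t = "(\<lambda>x \<in> carrier B. \<one>\<^bsub>A\<^esub>, d)"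
    have t: "?t \<in> carrier ?W"
      using top_closed[OF d(1)] .
    define w' where "w' = ?t \<otimes>\<^bsub>?W\<^esub> w \<otimes>\<^bsub>?W\<^esub> inv\<^bsub>?W\<^esub> ?t"
    have w': "w' \<in> carrier ?W"
      using t w by (simp add: w'_def)
    have "snd w' = snd v"
      using t w d by (simp add: w'_def)
    then obtain f g c where fg: "w' = (f, c)" "v = (g, c)"
      by (metis prod.collapse)
    have "\<not> conj_in ?W w' v"
    proof
      assume "conj_in ?W w' v"
      then obtain y where y: "y \<in> carrier ?W" "v = y \<otimes>\<^bsub>?W\<^esub> w' \<otimes>\<^bsub>?W\<^esub> inv\<^bsub>?W\<^esub> y"
        by (auto simp: conj_in_def)
      then have "v = (y \<otimes>\<^bsub>?W\<^esub> ?t) \<otimes>\<^bsub>?W\<^esub> w \<otimes>\<^bsub>?W\<^esub> inv\<^bsub>?W\<^esub> (y \<otimes>\<^bsub>?W\<^esub> ?t)"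
        using t w by (simp add: w'_def W.inv_mult_group W.m_assoc)
      then show False
        using nc y(1) t unfolding conj_in_def by blast
    qed
    then obtain Q :: "nat monoid" and \<beta> where Q: "finite_p_group p Q" "group_hom B Q \<beta>"
      "\<not> conj_in (A \<wreath> Q) (wreath_push A B Q \<beta> w') (wreath_push A B Q \<beta> v)"
      using nonconj_in_finite_top_quotient[OF p A(1) B, of f c g] w' v unfolding fg by blast
    interpret Q: wreath_groups A Q
      using Q(1) by (simp add: wreath_groups_def A.is_group finite_p_group_def p_group_def)
    note \<phi> = wreath_push_hom[OF A(1) Q(2)]
    have "p_separated p (A \<wreath> Q) (wreath_push A B Q \<beta> w') (wreath_push A B Q \<beta> v)"
      using p_conj_separable_wreath_finite[OF p A(2) Q(1)] Q(3)
        p_conj_separable_iff[OF p Q.W.is_group] hom_in_carrier[OF \<phi>] w' v by blast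
    then have "p_separated p ?W w' v"
      using p_separated_vimage[OF W.is_group Q.W.is_group \<phi> w' v] by blast
    then show ?thesis
      unfolding w'_def by (rule W.p_separated_conj[OF t w v])
  qed
  then show ?thesis
    by (simp add: p_conj_separable_iff[OF p W.is_group])
qed

section \<open>Obstructions to separability\<close>

context wreath_groups
begin

definition coord :: "'b \<Rightarrow> 'a \<Rightarrow> ('b \<Rightarrow> 'a) \<times> 'b" where
  "coord y a = (\<lambda>x \<in> carrier B. if x = y then a else \<one>\<^bsub>A\<^esub>, \<one>\<^bsub>B\<^esub>)"

definition top_elem :: "'b \<Rightarrow> ('b \<Rightarrow> 'a) \<times> 'b" where
  "top_elem b = (\<lambda>x \<in> carrier B. \<one>\<^bsub>A\<^esub>, b)"

lemma top_elem_hom: "group_hom B (A \<wreath> B) top_elem"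
proof
  show "top_elem \<in> hom B (A \<wreath> B)"
    using top_closed by (auto simp: hom_def top_elem_def mult_wreath)
qed

lemma coord_closed: "a \<in> carrier A \<Longrightarrow> coord y a \<in> carrier (A \<wreath> B)"
  by (auto simp: coord_def carrier_wreath intro: finite_subset[of _ "{y}"])

lemma coord_mult:
  assumes "a \<in> carrier A" "a' \<in> carrier A"
  shows "coord y a \<otimes>\<^bsub>A \<wreath> B\<^esub> coord y a' = coord y (a \<otimes>\<^bsub>A\<^esub> a')"
  using assms by (auto simp: coord_def mult_wreath fun_eq_iff)

lemma coord_one: "coord y \<one>\<^bsub>A\<^esub> = \<one>\<^bsub>A \<wreath> B\<^esub>"
  by (simp add: coord_def one_wreath)

lemma coord_commute:
  assumes "a \<in> carrier A" "a' \<in> carrier A" "y \<noteq> y' \<or> comm_group A"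
  shows "coord y a \<otimes>\<^bsub>A \<wreath> B\<^esub> coord y' a' = coord y' a' \<otimes>\<^bsub>A \<wreath> B\<^esub> coord y a"
  using assms comm_groupE(4)[of A] by (auto simp: coord_def mult_wreath fun_eq_iff)

lemma top_elem_coord:
  assumes "b \<in> carrier B" "y \<in> carrier B" "a \<in> carrier A"
  shows "top_elem b \<otimes>\<^bsub>A \<wreath> B\<^esub> coord y a = coord (b \<otimes>\<^bsub>B\<^esub> y) a \<otimes>\<^bsub>A \<wreath> B\<^esub> top_elem b"
proof -
  have "inv\<^bsub>B\<^esub> b \<otimes>\<^bsub>B\<^esub> x = y \<longleftrightarrow> x = b \<otimes>\<^bsub>B\<^esub> y" if "x \<in> carrier B" for x
    using assms that by (metis B.inv_solve_left)
  then show ?thesis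
    using assms by (auto simp: coord_def top_elem_def mult_wreath fun_eq_iff)
qed

text \<open>
  If the image of the coordinate subgroup at \<open>\<one>\<close> equals, in a finite quotient, the image of the one at
  \<open>m \<noteq> \<one>\<close>, it commutes with itself. Such an \<open>m\<close> exists because \<open>B\<close> cannot embed into a finite group.
\<close>

lemma comm_group_if_infinite_top:
  assumes p: "prime p" and W: "p_conj_separable p (A \<wreath> B)" and inf: "infinite (carrier B)"
  shows "comm_group A"
proof (rule A.group_comm_groupI, rule ccontr)
  fix a a' assume a: "a \<in> carrier A" "a' \<in> carrier A" "a \<otimes>\<^bsub>A\<^esub> a' \<noteq> a' \<otimes>\<^bsub>A\<^esub> a"
  let ?Z = "{coord \<one>\<^bsub>B\<^esub> (a \<otimes>\<^bsub>A\<^esub> a'), coord \<one>\<^bsub>B\<^esub> (a' \<otimes>\<^bsub>A\<^esub> a)}"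
  have "?Z \<subseteq> carrier (A \<wreath> B)"
    using a coord_closed by simp
  then obtain Q :: "nat monoid" and \<pi>
    where Q: "finite_p_group p Q" "group_hom (A \<wreath> B) Q \<pi>" "inj_on \<pi> ?Z"
    using p_conj_separable_inj_on[OF p W, of ?Z] by blast
  interpret \<pi>: group_hom "A \<wreath> B" Q \<pi> by fact
  interpret top_elem: group_hom B "A \<wreath> B" top_elem by (rule top_elem_hom)
  have "(\<pi> \<circ> top_elem) ` carrier B \<subseteq> carrier Q"
    by auto
  then have "\<not> inj_on (\<pi> \<circ> top_elem) (carrier B)"
    using inf Q(1) finite_imageD[of "\<pi> \<circ> top_elem" "carrier B"] finite_subset
    unfolding finite_p_group_def by blast
  then obtain k l where kl: "k \<in> carrier B" "l \<in> carrier B" "k \<noteq> l" "\<pi> (top_elem k) = \<pi> (top_elem l)"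
    by (auto simp: inj_on_def)
  define m where "m = inv\<^bsub>B\<^esub> k \<otimes>\<^bsub>B\<^esub> l"
  have m: "m \<in> carrier B" "\<one>\<^bsub>B\<^esub> \<noteq> m"
    using kl B.inv_solve_left[of "\<one>\<^bsub>B\<^esub>" k l] by (auto simp: m_def)
  have "\<pi> (top_elem m) = \<one>\<^bsub>Q\<^esub>"
    using kl by (simp add: m_def)
  then have shift: "\<pi> (coord \<one>\<^bsub>B\<^esub> a') = \<pi> (coord m a')"
    using arg_cong[OF top_elem_coord[OF m(1) B.one_closed a(2)], of \<pi>] m(1) a(2) coord_closed by simp
  have "\<pi> (coord \<one>\<^bsub>B\<^esub> (a \<otimes>\<^bsub>A\<^esub> a')) = \<pi> (coord \<one>\<^bsub>B\<^esub> a) \<otimes>\<^bsub>Q\<^esub> \<pi> (coord m a')"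
    using a shift by (simp add: coord_closed flip: coord_mult)
  also have "\<dots> = \<pi> (coord m a') \<otimes>\<^bsub>Q\<^esub> \<pi> (coord \<one>\<^bsub>B\<^esub> a)"
    using a m(2) arg_cong[OF coord_commute[of a a' "\<one>\<^bsub>B\<^esub>" m], of \<pi>] by (simp add: coord_closed)
  also have "\<dots> = \<pi> (coord \<one>\<^bsub>B\<^esub> (a' \<otimes>\<^bsub>A\<^esub> a))"
    using a shift by (simp add: coord_closed flip: coord_mult)
  finally have "coord \<one>\<^bsub>B\<^esub> (a \<otimes>\<^bsub>A\<^esub> a') = coord \<one>\<^bsub>B\<^esub> (a' \<otimes>\<^bsub>A\<^esub> a)"
    by (rule inj_onD[OF Q(3)]) simp_all
  from fun_cong[OF arg_cong[OF this, of fst], of "\<one>\<^bsub>B\<^esub>"] show False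
    using a(3) by (simp add: coord_def)
qed

text \<open>
  The conjugator is the product of the copies of \<open>a\<close> at \<open>\<one>, c, \<dots>, c\<^sup>j\<^sup>-\<^sup>1\<close>: comparing it with its
  translate by \<open>c\<close>, only the two ends of the chain survive.
\<close>

lemma top_elem_conj_telescope:
  assumes A: "comm_group A" and a: "a \<in> carrier A" and c: "c \<in> carrier B"
  shows "\<exists>w \<in> carrier (A \<wreath> B). w \<otimes>\<^bsub>A \<wreath> B\<^esub> top_elem c =
    coord \<one>\<^bsub>B\<^esub> a \<otimes>\<^bsub>A \<wreath> B\<^esub> coord (c [^]\<^bsub>B\<^esub> (j::nat)) (inv\<^bsub>A\<^esub> a) \<otimes>\<^bsub>A \<wreath> B\<^esub> top_elem c \<otimes>\<^bsub>A \<wreath> B\<^esub> w"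
proof (induction j)
  let ?W = "A \<wreath> B"
  interpret top_elem: group_hom B ?W top_elem by (rule top_elem_hom)
  note [simp] = coord_closed
  note [simp] = a c
  have cancel: "coord y a \<otimes>\<^bsub>?W\<^esub> coord y (inv\<^bsub>A\<^esub> a) = \<one>\<^bsub>?W\<^esub>" "coord y (inv\<^bsub>A\<^esub> a) \<otimes>\<^bsub>?W\<^esub> coord y a = \<one>\<^bsub>?W\<^esub>" for y
    by (simp_all add: coord_mult coord_one)
  {
    case 0
    show ?case
      by (intro bexI[of _ "\<one>\<^bsub>?W\<^esub>"]) (simp_all add: cancel)
  next
    case (Suc j)
    let ?y = "c [^]\<^bsub>B\<^esub> j"
    obtain w where w: "w \<in> carrier ?W"
      "w \<otimes>\<^bsub>?W\<^esub> top_elem c = coord \<one>\<^bsub>B\<^esub> a \<otimes>\<^bsub>?W\<^esub> coord ?y (inv\<^bsub>A\<^esub> a) \<otimes>\<^bsub>?W\<^esub> top_elem c \<otimes>\<^bsub>?W\<^esub> w"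
      using Suc by blast
    have cy: "c \<otimes>\<^bsub>B\<^esub> ?y = c [^]\<^bsub>B\<^esub> Suc j"
      using B.nat_pow_Suc2[OF c] by simp
    have "coord ?y a \<otimes>\<^bsub>?W\<^esub> w \<otimes>\<^bsub>?W\<^esub> top_elem c =
        coord ?y a \<otimes>\<^bsub>?W\<^esub> coord \<one>\<^bsub>B\<^esub> a \<otimes>\<^bsub>?W\<^esub> coord ?y (inv\<^bsub>A\<^esub> a) \<otimes>\<^bsub>?W\<^esub> top_elem c \<otimes>\<^bsub>?W\<^esub> w"
      using w by (simp add: W.m_assoc)
    also have "coord ?y a \<otimes>\<^bsub>?W\<^esub> coord \<one>\<^bsub>B\<^esub> a = coord \<one>\<^bsub>B\<^esub> a \<otimes>\<^bsub>?W\<^esub> coord ?y a"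
      by (rule coord_commute) (use A in simp_all)
    also have "coord \<one>\<^bsub>B\<^esub> a \<otimes>\<^bsub>?W\<^esub> coord ?y a \<otimes>\<^bsub>?W\<^esub> coord ?y (inv\<^bsub>A\<^esub> a) = coord \<one>\<^bsub>B\<^esub> a"
      by (simp add: W.m_assoc cancel)
    also have "coord \<one>\<^bsub>B\<^esub> a = coord \<one>\<^bsub>B\<^esub> a \<otimes>\<^bsub>?W\<^esub> coord (c \<otimes>\<^bsub>B\<^esub> ?y) (inv\<^bsub>A\<^esub> a) \<otimes>\<^bsub>?W\<^esub> coord (c \<otimes>\<^bsub>B\<^esub> ?y) a"
      by (simp add: W.m_assoc cancel)
    also have "\<dots> \<otimes>\<^bsub>?W\<^esub> top_elem c \<otimes>\<^bsub>?W\<^esub> w =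
        coord \<one>\<^bsub>B\<^esub> a \<otimes>\<^bsub>?W\<^esub> coord (c \<otimes>\<^bsub>B\<^esub> ?y) (inv\<^bsub>A\<^esub> a) \<otimes>\<^bsub>?W\<^esub> (coord (c \<otimes>\<^bsub>B\<^esub> ?y) a \<otimes>\<^bsub>?W\<^esub> top_elem c) \<otimes>\<^bsub>?W\<^esub> w"
      using w(1) by (simp add: W.m_assoc)
    also have "coord (c \<otimes>\<^bsub>B\<^esub> ?y) a \<otimes>\<^bsub>?W\<^esub> top_elem c = top_elem c \<otimes>\<^bsub>?W\<^esub> coord ?y a"
      using top_elem_coord[OF c _ a, of ?y] by simp
    finally show ?case
      using w(1) unfolding cy
      by (intro bexI[of _ "coord ?y a \<otimes>\<^bsub>?W\<^esub> w"]) (simp_all add: W.m_assoc)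
  }
qed

text \<open>
  Along the powers of \<open>c = b\<^sup>q\<close>, which pass through \<open>\<one>\<close> but miss \<open>b\<close>, a conjugator would have to
  be constant before \<open>\<one>\<close> and constant from \<open>\<one>\<close> on, with the jump \<open>a\<close> in between. A function of finite
  support has the value \<open>\<one>\<close> on both sides.
\<close>

lemma top_elem_nonconj:
  assumes b: "b \<in> carrier B" "B.ord b = 0" and q: "q > (1::nat)"
    and a: "a \<in> carrier A" "a \<noteq> \<one>\<^bsub>A\<^esub>"
  shows "\<not> conj_in (A \<wreath> B) (top_elem (b [^]\<^bsub>B\<^esub> q))
    (coord \<one>\<^bsub>B\<^esub> a \<otimes>\<^bsub>A \<wreath> B\<^esub> coord b (inv\<^bsub>A\<^esub> a) \<otimes>\<^bsub>A \<wreath> B\<^esub> top_elem (b [^]\<^bsub>B\<^esub> q))"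
proof
  let ?W = "A \<wreath> B" and ?c = "b [^]\<^bsub>B\<^esub> q"
  interpret top_elem: group_hom B ?W top_elem by (rule top_elem_hom)
  assume "conj_in ?W (top_elem ?c) (coord \<one>\<^bsub>B\<^esub> a \<otimes>\<^bsub>?W\<^esub> coord b (inv\<^bsub>A\<^esub> a) \<otimes>\<^bsub>?W\<^esub> top_elem ?c)"
  then obtain h d where h: "(h, d) \<in> carrier ?W"
    "(h, d) \<otimes>\<^bsub>?W\<^esub> top_elem ?c = coord \<one>\<^bsub>B\<^esub> a \<otimes>\<^bsub>?W\<^esub> coord b (inv\<^bsub>A\<^esub> a) \<otimes>\<^bsub>?W\<^esub> top_elem ?c \<otimes>\<^bsub>?W\<^esub> (h, d)"
    using a b by (auto simp: W.conj_in_iff_commute coord_closed)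
  note hc = wreath_closed[OF h(1)]
  have inj: "b [^]\<^bsub>B\<^esub> (i::int) = b [^]\<^bsub>B\<^esub> j \<longleftrightarrow> i = j" for i j
    using b by (auto simp: B.int_pow_eq)
  \<comment> \<open>The bi-infinite orbit of the identity under \<open>c\<close>.\<close>
  define y where "y i = b [^]\<^bsub>B\<^esub> (int q * i)" for i :: int
  have y: "y i \<in> carrier B" "y i = \<one>\<^bsub>B\<^esub> \<longleftrightarrow> i = 0" "y i \<noteq> b" "inv\<^bsub>B\<^esub> ?c \<otimes>\<^bsub>B\<^esub> y i = y (i - 1)" for i
  proof -
    show "y i \<in> carrier B" using b by (simp add: y_def)
    show "y i = \<one>\<^bsub>B\<^esub> \<longleftrightarrow> i = 0" using inj[of "int q * i" 0] q by (simp add: y_def)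
    have "int q * i \<noteq> 1"
    proof
      assume "int q * i = 1"
      then have "int q dvd 1" by (metis dvd_triv_left)
      then show False using q by simp
    qed
    then show "y i \<noteq> b" using inj[of "int q * i" 1] b by (simp add: y_def)
    have "?c \<otimes>\<^bsub>B\<^esub> y (i - 1) = b [^]\<^bsub>B\<^esub> (int q + int q * (i - 1))"
      using b by (simp add: y_def B.int_pow_mult flip: int_pow_int)
    also have "\<dots> = y i"
      by (simp add: y_def algebra_simps)
    finally have "y i = ?c \<otimes>\<^bsub>B\<^esub> y (i - 1)" by simp
    moreover have "y (i - 1) \<in> carrier B" using b by (simp add: y_def)
    ultimately show "inv\<^bsub>B\<^esub> ?c \<otimes>\<^bsub>B\<^esub> y i = y (i - 1)"
      using b by (simp add: B.m_assoc[symmetric])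
  qed
  have rec: "h (y i) = (if i = 0 then a else \<one>\<^bsub>A\<^esub>) \<otimes>\<^bsub>A\<^esub> h (y (i - 1))" for i
  proof -
    have "h x = (if x = \<one>\<^bsub>B\<^esub> then a else \<one>\<^bsub>A\<^esub>) \<otimes>\<^bsub>A\<^esub> (if x = b then inv\<^bsub>A\<^esub> a else \<one>\<^bsub>A\<^esub>) \<otimes>\<^bsub>A\<^esub>
        h (inv\<^bsub>B\<^esub> ?c \<otimes>\<^bsub>B\<^esub> x)" if x: "x \<in> carrier B" for x
      using fun_cong[OF arg_cong[OF h(2), of fst], of x] x a(1) b(1) hc(1,2)
      by (simp add: coord_def top_elem_def mult_wreath)
    from this[OF y(1)[of i]] show ?thesis
      using y(2,3)[of i] a(1) hc(2)[OF y(1)] by (simp add: y(4))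
  qed
  have "{i. h (y i) \<noteq> \<one>\<^bsub>A\<^esub>} \<subseteq> y -` {x \<in> carrier B. h x \<noteq> \<one>\<^bsub>A\<^esub>}"
    using y by auto
  moreover have "inj y"
    using inj q by (auto simp: inj_def y_def)
  ultimately have fin: "finite {i. h (y i) \<noteq> \<one>\<^bsub>A\<^esub>}"
    using finite_subset finite_vimageI[OF hc(3)] by blast
  have up: "h (y (int n)) = h (y 0)" for n
  proof (induction n)
    case (Suc n)
    have "int (Suc n) - 1 = int n" by simp
    then show ?case
      using Suc rec[of "int (Suc n)"] hc(2)[OF y(1)[of "int n"]] by simp
  qed simp
  have down: "h (y (- 1 - int n)) = h (y (- 1))" for n
  proof (induction n)
    case (Suc n)
    have "- 1 - int (Suc n) = (- 1 - int n) - 1" by simp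
    then show ?case
      using Suc rec[of "- 1 - int n"] hc(2)[OF y(1)[of "- 1 - int n - 1"]] by simp
  qed simp
  have "h (y 0) = \<one>\<^bsub>A\<^esub>"
  proof (rule ccontr)
    assume "h (y 0) \<noteq> \<one>\<^bsub>A\<^esub>"
    then have "range int \<subseteq> {i. h (y i) \<noteq> \<one>\<^bsub>A\<^esub>}"
      using up by auto
    then have "finite (range int)"
      using fin by (rule finite_subset)
    then show False
      using range_inj_infinite[OF inj_of_nat] by blast
  qed
  moreover have "h (y (- 1)) = \<one>\<^bsub>A\<^esub>"
  proof (rule ccontr)
    assume "h (y (- 1)) \<noteq> \<one>\<^bsub>A\<^esub>"
    then have "range (\<lambda>n. - 1 - int n) \<subseteq> {i. h (y i) \<noteq> \<one>\<^bsub>A\<^esub>}"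
      using down by auto
    then have "finite (range (\<lambda>n. - 1 - int n))"
      using fin by (rule finite_subset)
    moreover have "inj (\<lambda>n. - 1 - int n)"
      by (simp add: inj_def)
    ultimately show False
      using range_inj_infinite by blast
  qed
  ultimately show False
    using rec[of 0] a by simp
qed

text \<open>
  For \<open>b\<close> of infinite order and \<open>c = b\<^sup>p\<^sup>+\<^sup>1\<close>, a finite \<open>p\<close>-quotient cannot tell \<open>b\<close> from
  a suitable power \<open>c\<^sup>j\<close>, as \<open>p + 1\<close> is prime to \<open>p\<close>. There the telescoping conjugation, which moves
  the second factor to the coordinate \<open>c\<^sup>j\<close>, moves it to the coordinate \<open>b\<close>, contrary to nonconjugacy.
\<close>

lemma top_torsion:
  assumes p: "prime p" and W: "p_conj_separable p (A \<wreath> B)"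
    and a: "a \<in> carrier A" "a \<noteq> \<one>\<^bsub>A\<^esub>" and b: "b \<in> carrier B"
  shows "B.ord b \<noteq> 0"
proof
  let ?W = "A \<wreath> B"
  assume ord: "B.ord b = 0"
  have "infinite (carrier B)"
    using B.ord_ge_1[OF _ b] ord by auto
  then have A: "comm_group A"
    by (rule comm_group_if_infinite_top[OF p W])
  interpret top_elem: group_hom B ?W top_elem by (rule top_elem_hom)
  let ?q = "p + 1"
  define c where "c = b [^]\<^bsub>B\<^esub> ?q"
  have c[simp]: "c \<in> carrier B"
    using b by (simp add: c_def)
  let ?w = "coord \<one>\<^bsub>B\<^esub> a \<otimes>\<^bsub>?W\<^esub> coord b (inv\<^bsub>A\<^esub> a) \<otimes>\<^bsub>?W\<^esub> top_elem c"
  note [simp] = a(1) b coord_closed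
  have "\<not> conj_in ?W (top_elem c) ?w"
    using top_elem_nonconj[OF b ord _ a, of ?q] prime_gt_0_nat[OF p] by (simp add: c_def)
  then have "p_separated p ?W (top_elem c) ?w"
    using p_conj_separable_iff[OF p W.is_group] W by auto
  then obtain N where N: "p_open p ?W N"
    "\<And>x. x \<in> carrier ?W \<Longrightarrow> x \<otimes>\<^bsub>?W\<^esub> top_elem c \<otimes>\<^bsub>?W\<^esub> inv\<^bsub>?W\<^esub> x \<otimes>\<^bsub>?W\<^esub> inv\<^bsub>?W\<^esub> ?w \<notin> N"
    unfolding p_separated_def by blast
  obtain Q :: "nat monoid" and \<pi> where Q: "finite_p_group p Q" "group_hom ?W Q \<pi>" "N = kernel ?W Q \<pi>"
    using p_openE[OF N(1) W.is_group] by blast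
  interpret \<pi>: group_hom ?W Q \<pi> by fact
  obtain k where k: "\<pi> (top_elem b) [^]\<^bsub>Q\<^esub> (p ^ k) = \<one>\<^bsub>Q\<^esub>"
    using finite_p_group_exponent[OF p Q(1)] by (metis \<pi>.hom_closed b top_elem.hom_closed)
  have "coprime ?q (p ^ k)"
    by simp
  then obtain j l where jl: "?q * j = p ^ k * l + 1"
    using bezout_nat[of ?q "p ^ k"] by (auto simp: coprime_iff_gcd_eq_1)
  have "\<pi> (top_elem (c [^]\<^bsub>B\<^esub> j)) = \<pi> (top_elem b) [^]\<^bsub>Q\<^esub> (?q * j)"
    by (simp only: c_def B.nat_pow_pow b top_elem.hom_nat_pow \<pi>.hom_nat_pow top_elem.hom_closed)
  also have "\<dots> = \<pi> (top_elem b)"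
    unfolding jl using k by (simp add: \<pi>.H.nat_pow_mult[symmetric] \<pi>.H.nat_pow_pow[symmetric])
  finally have \<pi>c: "\<pi> (top_elem (c [^]\<^bsub>B\<^esub> j)) = \<pi> (top_elem b)" .
  have coord_conj: "\<pi> (coord y (inv\<^bsub>A\<^esub> a)) =
      \<pi> (top_elem y) \<otimes>\<^bsub>Q\<^esub> \<pi> (coord \<one>\<^bsub>B\<^esub> (inv\<^bsub>A\<^esub> a)) \<otimes>\<^bsub>Q\<^esub> inv\<^bsub>Q\<^esub> \<pi> (top_elem y)" if y: "y \<in> carrier B" for y
  proof -
    have "\<pi> (top_elem y) \<otimes>\<^bsub>Q\<^esub> \<pi> (coord \<one>\<^bsub>B\<^esub> (inv\<^bsub>A\<^esub> a)) = \<pi> (coord y (inv\<^bsub>A\<^esub> a)) \<otimes>\<^bsub>Q\<^esub> \<pi> (top_elem y)"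
      using arg_cong[OF top_elem_coord[OF y B.one_closed A.inv_closed[OF a(1)]], of \<pi>] y by simp
    then show ?thesis
      by (subst \<pi>.H.inv_solve_right) (use y in simp_all)
  qed
  have "\<pi> (coord (c [^]\<^bsub>B\<^esub> j) (inv\<^bsub>A\<^esub> a)) = \<pi> (coord b (inv\<^bsub>A\<^esub> a))"
    unfolding coord_conj[OF b] coord_conj[OF B.nat_pow_closed[OF c]] \<pi>c by (rule refl)
  moreover obtain w where w: "w \<in> carrier ?W"
    "w \<otimes>\<^bsub>?W\<^esub> top_elem c = coord \<one>\<^bsub>B\<^esub> a \<otimes>\<^bsub>?W\<^esub> coord (c [^]\<^bsub>B\<^esub> j) (inv\<^bsub>A\<^esub> a) \<otimes>\<^bsub>?W\<^esub> top_elem c \<otimes>\<^bsub>?W\<^esub> w"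
    using top_elem_conj_telescope[OF A a(1) c, of j] by (rule bexE)
  moreover have "\<pi> w \<otimes>\<^bsub>Q\<^esub> \<pi> (top_elem c) = \<pi> (w \<otimes>\<^bsub>?W\<^esub> top_elem c)"
    using w(1) by simp
  ultimately have "\<pi> w \<otimes>\<^bsub>Q\<^esub> \<pi> (top_elem c) = \<pi> ?w \<otimes>\<^bsub>Q\<^esub> \<pi> w"
    unfolding w(2) using w(1) by simp
  then show False
    using N(2)[OF w(1)] w(1) unfolding Q(3)
    using \<pi>.conj_in_kernel_coset_iff[OF w(1), of "top_elem c" ?w] by simp
qed

end

text \<open>
  If the order of \<open>b\<close> is \<open>p\<^sup>v r\<close> with \<open>r\<close> prime to \<open>p\<close>, then \<open>b\<close> raised to \<open>p\<^sup>v\<close> has order dividing \<open>r\<close> and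
  is killed by every homomorphism to a finite \<open>p\<close>-group, so it is trivial by residual finiteness.
\<close>

lemma p_group_if_torsion:
  assumes p: "prime p" and B: "p_conj_separable p B"
    and torsion: "\<And>b. b \<in> carrier B \<Longrightarrow> group.ord B b \<noteq> 0"
  shows "p_group p B"
proof -
  interpret B: group B
    using B by (simp add: p_conj_separable_def)
  have "\<exists>k::nat. b [^]\<^bsub>B\<^esub> (p ^ k) = \<one>\<^bsub>B\<^esub>" if b: "b \<in> carrier B" for b
  proof -
    obtain v r where r: "B.ord b = p ^ v * r" "\<not> p dvd r"
      using prime_power_canonical[OF p, of "B.ord b"] torsion[OF b] by (auto simp: mult.commute)
    let ?y = "b [^]\<^bsub>B\<^esub> (p ^ v)"
    have "?y = \<one>\<^bsub>B\<^esub>"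
    proof (rule ccontr)
      assume ne: "?y \<noteq> \<one>\<^bsub>B\<^esub>"
      obtain Q :: "nat monoid" and \<pi>
        where Q: "finite_p_group p Q" "group_hom B Q \<pi>" "inj_on \<pi> {?y, \<one>\<^bsub>B\<^esub>}"
        using p_conj_separable_inj_on[OF p B, of "{?y, \<one>\<^bsub>B\<^esub>}"] b by auto
      interpret \<pi>: group_hom B Q \<pi> by fact
      have y: "?y \<in> carrier B" using b by simp
      obtain k where "\<pi> ?y [^]\<^bsub>Q\<^esub> (p ^ k) = \<one>\<^bsub>Q\<^esub>"
        using finite_p_group_exponent[OF p Q(1)] by (metis \<pi>.hom_closed y)
      then have "\<pi>.H.ord (\<pi> ?y) dvd p ^ k"
        using y by (simp add: \<pi>.H.pow_eq_id)
      moreover have "?y [^]\<^bsub>B\<^esub> r = \<one>\<^bsub>B\<^esub>"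
        using B.pow_ord_eq_1[OF b] b by (simp add: B.nat_pow_pow r(1))
      then have "\<pi>.H.ord (\<pi> ?y) dvd r"
        using \<pi>.hom_nat_pow[OF y, of r] y by (simp add: \<pi>.H.pow_eq_id[symmetric] del: \<pi>.hom_nat_pow)
      moreover have "coprime (p ^ k) r"
        using p r(2) by (simp add: prime_imp_coprime)
      ultimately have "\<pi>.H.ord (\<pi> ?y) = 1"
        using coprime_common_divisor_nat by blast
      then have "\<pi> ?y = \<one>\<^bsub>Q\<^esub>"
        using y \<pi>.H.ord_eq_1[of "\<pi> ?y"] \<pi>.hom_closed by blast
      then show False
        using ne Q(3) by (auto simp: inj_on_def)
    qed
    then show ?thesis by blast
  qed
  then show ?thesis
    using p_group_iff_pow[OF p] B.is_group by blast
qed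

section \<open>The characterisation\<close>

theorem corollary1p1:
  fixes p :: nat
    and A :: "('a, 'k) monoid_scheme"
    and B :: "('b, 'm) monoid_scheme"
  assumes "prime p"
    and "group A" and "group B"
    and "p_conj_separable p A" and "p_conj_separable p B"
  shows "(finite_p_group p B \<or> (comm_group A \<and> p_group p B) \<longrightarrow> p_conj_separable p (A \<wreath> B)) \<and>
         (\<not> trivial_group A \<longrightarrow>
            p_conj_separable p (A \<wreath> B) \<longrightarrow> finite_p_group p B \<or> (comm_group A \<and> p_group p B))"
proof (intro conjI impI)
  assume "finite_p_group p B \<or> (comm_group A \<and> p_group p B)"
  then show "p_conj_separable p (A \<wreath> B)"
    using p_conj_separable_wreath_finite p_conj_separable_wreath_abelian assms by blast
next
  interpret wreath_groups A B
    using assms by (simp add: wreath_groups_def)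
  assume "\<not> trivial_group A" and W: "p_conj_separable p (A \<wreath> B)"
  then obtain a where a: "a \<in> carrier A" "a \<noteq> \<one>\<^bsub>A\<^esub>"
    using assms(2) A.one_closed by (auto simp: trivial_group_def)
  have "p_group p B"
    using p_group_if_torsion[OF assms(1,5)] top_torsion[OF assms(1) W a] by blast
  then show "finite_p_group p B \<or> (comm_group A \<and> p_group p B)"
    using comm_group_if_infinite_top[OF assms(1) W] by (auto simp: finite_p_group_def)
qed

end
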